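(* Let $g^\star,m^\star\ge 1$ and let $\theta^\star=(\pi^\star,\rho^\star,\alpha^\star)$ be the (fixed) parameter of a binary latent block model with $g^\star$ row classes and $m^\star$ column classes, such that $\pi^\star_{\min}\rho^\star_{\min}>0$ and $\delta_{\pi^\star}\delta_{\rho^\star}>0$. Consider data matrices $X$ of size $n\times d$ with $n,d\to+\infty$, and positive thresholds $S_g^{n,d},S_m^{n,d}$ such that $$S_g^{n,d}\underset{n,d\to+\infty}{\longrightarrow}0,\qquad S_m^{n,d}\underset{n,d\to+\infty}{\longrightarrow}0,$$ $$\liminf_{n,d\to+\infty}S_g^{n,d}\sqrt{\frac{d}{\log n}}>\sqrt2\qquad\text{and}\qquad\liminf_{n,d\to+\infty}S_m^{n,d}\sqrt{\frac{n}{\log d}}>\sqrt2 .$$ Let $\hat g,\hat m,\hat{\mathbf z},\hat{\mathbf w},\hat\theta$ be the output of the Largest Gaps algorithm applied to $X$ with thresholds $S_g^{n,d},S_m^{n,d}$. Then, for all $t>0$, $$\mathbb P\Big(\hat g\neq g^\star\ \text{or}\ \hat m\neq m^\star\ \text{or}\ \hat{\mathbf z}\not\equiv_{\mathcal Z}\mathbf z^\star\ \text{or}\ \hat{\mathbf w}\not\equiv_{\mathcal W}\mathbf w^\star\ \text{or}\ d^\infty\big(\hat\theta^{s_{\mathcal Z},t_{\mathcal W}},\theta^\star\big)>t\Big)\underset{n,d\to+\infty}{\longrightarrow}0 .$$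
   Context: All limits "$n,d\to+\infty$" are taken along a given sequence of pairs $(n,d)$ in which both $n$ and $d$ tend to $+\infty$. **Binary latent block model.** The parameter is $\theta^\star=(\pi^\star,\rho^\star,\alpha^\star)$, where $\pi^\star=(\pi^\star_1,\dots,\pi^\star_{g^\star})$ and $\rho^\star=(\rho^\star_1,\dots,\rho^\star_{m^\star})$ are probability vectors and $\alpha^\star=(\alpha^\star_{k\ell})\in[0,1]^{g^\star\times m^\star}$. For integers $n,d\ge1$, the latent row partition $\mathbf z^\star\in\{0,1\}^{n\times g^\star}$ is a random matrix with independent rows, each having exactly one entry equal to $1$, with $\mathbb P(z^\star_{ik}=1)=\pi^\star_k$. The latent column partition $\mathbf w^\star\in\{0,1\}^{d\times m^\star}$ is independent of $\mathbf z^\star$ and has independent rows, each having exactly one entry equal to $1$, with $\mathbb P(w^\star_{j\ell}=1)=\rho^\star_\ell$. Conditionally on $(\mathbf z^\star,\mathbf w^\star)$, the entries $X_{ij}\in\{0,1\}$ ($1\le i\le n$, $1\le j\le d$) are independent, $X_{ij}$ being Bernoulli with parameter $\alpha^\star_{k\ell}$ when $z^\star_{ik}w^\star_{j\ell}=1$. Only $X$ is observed. **Key parameters.** $\pi^\star_{\min}=\min_k\pi^\star_k$, $\rho^\star_{\min}=\min_\ell\rho^\star_\ell$, $\tau^\star_k=\sum_{\ell}\alpha^\star_{k\ell}\rho^\star_\ell$, $\xi^\star_\ell=\sum_k\pi^\star_k\alpha^\star_{k\ell}$, $\delta_{\pi^\star}=\min_{k\ne k'}|\tau^\star_k-\tau^\star_{k'}|$,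 $\delta_{\rho^\star}=\min_{\ell\neq\ell'}|\xi^\star_\ell-\xi^\star_{\ell'}|$ (a minimum over an empty set is $+\infty$). **Largest Gaps algorithm** (input $X$, thresholds $S_g,S_m>0$). Compute the row means $\overline{X_{i\cdot}}=\frac1d\sum_{j}X_{ij}$, sort them in ascending order $\overline{X_{(1)\cdot}}\le\dots\le\overline{X_{(n)\cdot}}$, and compute the gaps $G_i=\overline{X_{(i)\cdot}}-\overline{X_{(i-1)\cdot}}$, $2\le i\le n$. Let $i_1<\dots<i_{\hat g-1}$ be all the indices $i$ with $G_i>S_g$ (this defines $\hat g$). Put $i_0=1$, $i_{\hat g}=n+1$; define $\hat{\mathbf z}\in\{0,1\}^{n\times\hat g}$ by $\hat z_{(i)k}=1$ iff $i_{k-1}\le i<i_k$. That is, two consecutive sorted rows are put in different clusters exactly when the gap between them exceeds $S_g$. Define $\hat m$ and $\hat{\mathbf w}\in\{0,1\}^{d\times\hat m}$ in the same way from the column means $\frac1n\sum_iX_{ij}$ with threshold $S_m$. With $\hat z_{+k}=\sum_i\hat z_{ik}$ and $\hat w_{+\ell}=\sum_j\hat w_{j\ell}$, set $\hat\pi_k=\hat z_{+k}/n$, $\hat\rho_\ell=\hat w_{+\ell}/d$, $\hat\alpha_{k\ell}=\frac{\sum_{i,j}\hat z_{ik}\hat w_{j\ell}X_{ij}}{\hat z_{+k}\hat w_{+\ell}}$ and $\hat\theta=(\hat\pi,\hat\rho,\hat\alpha)$. **Label switching.** For $0/1$ matrices $\mathbf z,\mathbf z'$ with $n$ rows and the same number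 $g$ of columns, $\mathbf z\equiv_{\mathcal Z}\mathbf z'$ means that there is a permutation $s$ of $\{1,\dots,g\}$ with $z'_{i,s(k)}=z_{ik}$ for all $i,k$; matrices with different numbers of columns are not equivalent. $\equiv_{\mathcal W}$ is defined in the same way for column partitions. On $\{\hat{\mathbf z}\equiv_{\mathcal Z}\mathbf z^\star\}$, $s_{\mathcal Z}$ is the (unique) permutation with $\hat z_{i,s_{\mathcal Z}(k)}=z^\star_{ik}$ for all $i,k$; elsewhere it is the identity of $\{1,\dots,\hat g\}$. $t_{\mathcal W}$ is defined in the same way from $\hat{\mathbf w}$ and $\mathbf w^\star$. For $\theta=(\pi,\rho,\alpha)$ and permutations $s,t$ of the row and column class labels, $\theta^{s,t}=\big((\pi_{s(k)})_k,(\rho_{t(\ell)})_\ell,(\alpha_{s(k),t(\ell)})_{k,\ell}\big)$. **Distance.** $d^\infty(\theta,\theta')$ is the maximum of the absolute values of the coordinates of $\theta-\theta'$ (over all coordinates of $\pi,\rho,\alpha$) if $\theta,\theta'$ have the same numbers of row and column classes, and $+\infty$ otherwise. *)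

theory Defs
  imports "HOL-Probability.Probability" "Jordan_Normal_Form.Matrix"
begin

text \<open>
  Row, column and class labels are numbered from \<open>0\<close>. The matrices \<open>X\<close>, \<open>z\<close>, \<open>w\<close> are real
  matrices with entries in \<open>{0, 1}\<close>; as their dimensions are part of the value, an estimated
  partition carries its own (random) number of classes.
\<close>

unbundle no vec_syntax

hide_const (open) Finite_Cartesian_Product.vec Finite_Cartesian_Product.mat

section \<open>The binary latent block model\<close>

record lbm_param =
  row_prop :: "real vec"
  col_prop :: "real vec"
  conn :: "real mat"

definition prob_vec :: "real vec \<Rightarrow> bool" where
  "prob_vec p \<longleftrightarrow> (\<forall>k<dim_vec p. 0 \<le> p $ k) \<and> (\<Sum>k<dim_vec p. p $ k) = 1"

definition lbm_parameter :: "nat \<Rightarrow> nat \<Rightarrow> lbm_param \<Rightarrow> bool" where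
  "lbm_parameter g m \<theta> \<longleftrightarrow>
     row_prop \<theta> \<in> carrier_vec g \<and> prob_vec (row_prop \<theta>) \<and>
     col_prop \<theta> \<in> carrier_vec m \<and> prob_vec (col_prop \<theta>) \<and>
     conn \<theta> \<in> carrier_mat g m \<and> (\<forall>k<g. \<forall>l<m. 0 \<le> conn \<theta> $$ (k, l) \<and> conn \<theta> $$ (k, l) \<le> 1)"

definition class_pmf :: "real vec \<Rightarrow> nat pmf" where
  "class_pmf p = embed_pmf (\<lambda>k. if k < dim_vec p then p $ k else 0)"

text \<open>\<^const>\<open>embed_pmf\<close> is only meaningful for nonnegative functions of total mass \<open>1\<close>.\<close>

lemma pmf_class_pmf:
  assumes "prob_vec p"
  shows "pmf (class_pmf p) k = (if k < dim_vec p then p $ k else 0)"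
proof -
  have "(\<integral>\<^sup>+ k. ennreal (if k < dim_vec p then p $ k else 0) \<partial>count_space UNIV)
      = (\<Sum>k<dim_vec p. ennreal (if k < dim_vec p then p $ k else 0))"
    by (rule nn_integral_count_space'[where A = "{..<dim_vec p}"]) auto
  also have "\<dots> = (\<Sum>k<dim_vec p. ennreal (p $ k))"
    by (rule sum.cong) auto
  also have "\<dots> = ennreal (\<Sum>k<dim_vec p. p $ k)"
    using assms by (intro sum_ennreal) (auto simp: prob_vec_def)
  also have "\<dots> = 1"
    using assms by (simp add: prob_vec_def)
  finally show ?thesis
    unfolding class_pmf_def using assms by (subst pmf_embed_pmf) (auto simp: prob_vec_def)
qed

definition partition_pmf :: "real vec \<Rightarrow> nat \<Rightarrow> real mat pmf" where
  "partition_pmf p n =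
     map_pmf (\<lambda>c. mat n (dim_vec p) (\<lambda>(i, k). of_bool (c i = k)))
       (Pi_pmf {..<n} 0 (\<lambda>_. class_pmf p))"

text \<open>
  Exactly one summand of the double sum below is nonzero: it is the connection probability of the
  class of row \<open>i\<close> and the class of column \<open>j\<close>.
\<close>

definition data_pmf :: "lbm_param \<Rightarrow> real mat \<Rightarrow> real mat \<Rightarrow> real mat pmf" where
  "data_pmf \<theta> z w =
     map_pmf (\<lambda>x. mat (dim_row z) (dim_row w) (\<lambda>ij. of_bool (x ij)))
       (Pi_pmf ({..<dim_row z} \<times> {..<dim_row w}) False
         (\<lambda>(i, j). bernoulli_pmf
           (\<Sum>k<dim_col z. \<Sum>l<dim_col w. z $$ (i, k) * w $$ (j, l) * conn \<theta> $$ (k, l))))"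

definition lbm_pmf :: "lbm_param \<Rightarrow> nat \<Rightarrow> nat \<Rightarrow> (real mat \<times> real mat \<times> real mat) pmf" where
  "lbm_pmf \<theta> n d =
     bind_pmf (partition_pmf (row_prop \<theta>) n) (\<lambda>z.
     bind_pmf (partition_pmf (col_prop \<theta>) d) (\<lambda>w.
     bind_pmf (data_pmf \<theta> z w) (\<lambda>X.
     return_pmf (z, w, X))))"

section \<open>Key parameters\<close>

definition vec_min :: "real vec \<Rightarrow> real" where
  "vec_min p = Min ((\<lambda>k. p $ k) ` {..<dim_vec p})"

definition tau :: "lbm_param \<Rightarrow> nat \<Rightarrow> real" where
  "tau \<theta> k = (\<Sum>l<dim_vec (col_prop \<theta>). conn \<theta> $$ (k, l) * col_prop \<theta> $ l)"

definition xi :: "lbm_param \<Rightarrow> nat \<Rightarrow> real" where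
  "xi \<theta> l = (\<Sum>k<dim_vec (row_prop \<theta>). row_prop \<theta> $ k * conn \<theta> $$ (k, l))"

text \<open>In \<^typ>\<open>ereal\<close>, the infimum over the empty set (a single class) is \<open>\<infinity>\<close>.\<close>

definition min_separation :: "nat \<Rightarrow> (nat \<Rightarrow> real) \<Rightarrow> ereal" where
  "min_separation g f = (INF (k, k') \<in> {(k, k'). k < g \<and> k' < g \<and> k \<noteq> k'}. ereal \<bar>f k - f k'\<bar>)"

definition delta_row :: "lbm_param \<Rightarrow> ereal" where
  "delta_row \<theta> = min_separation (dim_vec (row_prop \<theta>)) (tau \<theta>)"

definition delta_col :: "lbm_param \<Rightarrow> ereal" where
  "delta_col \<theta> = min_separation (dim_vec (col_prop \<theta>)) (xi \<theta>)"

section \<open>The Largest Gaps algorithm\<close>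

text \<open>
  Ties between row means are broken by the row index (stable sort); for a threshold \<open>S \<ge> 0\<close> the
  partition does not depend on this choice, since a gap between tied rows is \<open>0\<close>.
  The break points are \<open>i\<^sub>0, \<dots>, i\<^sub>g\<close>, where \<open>g\<close> is the estimated number of classes, shifted by
  one because sorted positions start at \<open>0\<close>.
\<close>

definition row_mean :: "real mat \<Rightarrow> nat \<Rightarrow> real" where
  "row_mean X i = (\<Sum>j<dim_col X. X $$ (i, j)) / real (dim_col X)"

definition sorted_rows :: "real mat \<Rightarrow> nat list" where
  "sorted_rows X = sort_key (row_mean X) [0..<dim_row X]"

definition gap :: "real mat \<Rightarrow> nat \<Rightarrow> real" where
  "gap X p = row_mean X (sorted_rows X ! p) - row_mean X (sorted_rows X ! (p - 1))"

definition break_points :: "real \<Rightarrow> real mat \<Rightarrow> nat list" where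
  "break_points S X = [0] @ filter (\<lambda>p. gap X p > S) [1..<dim_row X] @ [dim_row X]"

definition lg_classes :: "real \<Rightarrow> real mat \<Rightarrow> nat" where
  "lg_classes S X = length (break_points S X) - 1"

definition lg_partition :: "real \<Rightarrow> real mat \<Rightarrow> real mat" where
  "lg_partition S X = mat (dim_row X) (lg_classes S X)
     (\<lambda>(i, k). of_bool (\<exists>p. break_points S X ! k \<le> p \<and> p < break_points S X ! Suc k \<and>
                            sorted_rows X ! p = i))"

definition g_hat :: "real \<Rightarrow> real mat \<Rightarrow> nat" where
  "g_hat Sg X = lg_classes Sg X"

definition m_hat :: "real \<Rightarrow> real mat \<Rightarrow> nat" where
  "m_hat Sm X = lg_classes Sm (transpose_mat X)"

definition z_hat :: "real \<Rightarrow> real mat \<Rightarrow> real mat" where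
  "z_hat Sg X = lg_partition Sg X"

definition w_hat :: "real \<Rightarrow> real mat \<Rightarrow> real mat" where
  "w_hat Sm X = lg_partition Sm (transpose_mat X)"

definition class_size :: "real mat \<Rightarrow> nat \<Rightarrow> real" where
  "class_size z k = (\<Sum>i<dim_row z. z $$ (i, k))"

definition block_estimate :: "real mat \<Rightarrow> real mat \<Rightarrow> real mat \<Rightarrow> lbm_param" where
  "block_estimate z w X =
     \<lparr> row_prop = vec (dim_col z) (\<lambda>k. class_size z k / real (dim_row z)),
       col_prop = vec (dim_col w) (\<lambda>l. class_size w l / real (dim_row w)),
       conn = mat (dim_col z) (dim_col w) (\<lambda>(k, l).
         (\<Sum>i<dim_row z. \<Sum>j<dim_row w. z $$ (i, k) * w $$ (j, l) * X $$ (i, j))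
           / (class_size z k * class_size w l)) \<rparr>"

definition theta_hat :: "real \<Rightarrow> real \<Rightarrow> real mat \<Rightarrow> lbm_param" where
  "theta_hat Sg Sm X = block_estimate (z_hat Sg X) (w_hat Sm X) X"

section \<open>Label switching and distance\<close>

definition switches :: "(nat \<Rightarrow> nat) \<Rightarrow> real mat \<Rightarrow> real mat \<Rightarrow> bool" where
  "switches s z z' \<longleftrightarrow>
     dim_row z = dim_row z' \<and> dim_col z = dim_col z' \<and> s permutes {..<dim_col z} \<and>
     (\<forall>i<dim_row z. \<forall>k<dim_col z. z' $$ (i, s k) = z $$ (i, k))"

definition part_equiv :: "real mat \<Rightarrow> real mat \<Rightarrow> bool" where
  "part_equiv z z' \<longleftrightarrow> (\<exists>s. switches s z z')"

text \<open>
  The permutation is unique when no class of the estimate is empty, which holds for the estimates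
  of the Largest Gaps algorithm on nonempty data.
\<close>

definition switching_perm :: "real mat \<Rightarrow> real mat \<Rightarrow> nat \<Rightarrow> nat" where
  "switching_perm zest zstar =
     (if part_equiv zest zstar then (THE s. switches s zstar zest) else id)"

definition permute_param :: "(nat \<Rightarrow> nat) \<Rightarrow> (nat \<Rightarrow> nat) \<Rightarrow> lbm_param \<Rightarrow> lbm_param" where
  "permute_param s t \<theta> =
     \<lparr> row_prop = vec (dim_vec (row_prop \<theta>)) (\<lambda>k. row_prop \<theta> $ s k),
       col_prop = vec (dim_vec (col_prop \<theta>)) (\<lambda>l. col_prop \<theta> $ t l),
       conn = mat (dim_row (conn \<theta>)) (dim_col (conn \<theta>)) (\<lambda>(k, l). conn \<theta> $$ (s k, t l)) \<rparr>"

definition dinf :: "lbm_param \<Rightarrow> lbm_param \<Rightarrow> ereal" where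
  "dinf \<theta> \<theta>' =
     (let g = dim_vec (row_prop \<theta>); m = dim_vec (col_prop \<theta>) in
      if g = dim_vec (row_prop \<theta>') \<and> m = dim_vec (col_prop \<theta>')
      then ereal (Max
        ((\<lambda>k. \<bar>row_prop \<theta> $ k - row_prop \<theta>' $ k\<bar>) ` {..<g} \<union>
         (\<lambda>l. \<bar>col_prop \<theta> $ l - col_prop \<theta>' $ l\<bar>) ` {..<m} \<union>
         (\<lambda>kl. \<bar>conn \<theta> $$ kl - conn \<theta>' $$ kl\<bar>) ` ({..<g} \<times> {..<m})))
      else \<infinity>)"

end

theory Submission
  imports Defs
begin

text \<open>
  Given the row labels, averaging over the column labels makes the entries of a row with label \<open>k\<close>
  independent Bernoulli variables with parameter \<open>\<tau>\<^sub>k\<close>. By Hoeffding's inequality and a union bound, with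
  probability at least \<open>1 - 2 n exp (- d S\<^sub>g\<^sup>2 / 2)\<close> every row mean is within \<open>S\<^sub>g / 2\<close> of its centre
  \<open>\<tau>\<^sub>k\<close>. Once \<open>2 S\<^sub>g < \<delta>\<^sub>\<pi>\<close>, two row means are then within \<open>S\<^sub>g\<close> of each other exactly when the
  rows have the same label, so the gaps larger than \<open>S\<^sub>g\<close> in the sorted sequence are exactly the label
  changes. The condition \<open>liminf S\<^sub>g sqrt (d / log n) > sqrt 2\<close> is what makes the failure probability a
  negative power of \<open>n\<close>. The columns are symmetric. On the event of exact recovery the relabelled
  estimator is the one built from the true partitions, whose proportions and block means are again
  averages of independent variables.
\<close>

section \<open>Products of probability mass functions\<close>

text \<open>Induction on \<open>B\<close>. Injectivity makes \<open>h b\<close> a coordinate outside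
  the image of the smaller set, so its draw is independent of the others, and setting it does not
  disturb the coordinates read through \<open>h\<close> at the other points.\<close>

lemma Pi_pmf_reindex:
  assumes "finite B" and "inj_on h B"
  shows "map_pmf (\<lambda>x b. if b \<in> B then x (h b) else dflt) (Pi_pmf (h ` B) dflt q)
       = Pi_pmf B dflt (\<lambda>b. q (h b))"
  using assms
proof (induction B rule: finite_induct)
  case empty
  then show ?case by simp
next
  case (insert b B)
  have nin: "h b \<notin> h ` B" using insert by auto
  then have ne: "h b' \<noteq> h b" if "b' \<in> B" for b' using that by (metis imageI)
  have "map_pmf (\<lambda>x b'. if b' \<in> insert b B then x (h b') else dflt)
          (Pi_pmf (insert (h b) (h ` B)) dflt q)
      = map_pmf (\<lambda>(a, f) b'. if b' \<in> insert b B then (f(h b := a)) (h b') else dflt)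
          (pair_pmf (q (h b)) (Pi_pmf (h ` B) dflt q))"
    using insert.hyps nin by (subst Pi_pmf_insert) (auto simp: map_pmf_comp case_prod_unfold)
  also have "\<dots> = map_pmf (\<lambda>(a, f). f(b := a))
       (pair_pmf (q (h b)) (map_pmf (\<lambda>x b. if b \<in> B then x (h b) else dflt) (Pi_pmf (h ` B) dflt q)))"
    using insert.hyps insert.prems nin unfolding pair_map_pmf2 map_pmf_comp
    by (intro map_pmf_cong refl) (auto simp: fun_eq_iff ne)
  also have "\<dots> = map_pmf (\<lambda>(a, f). f(b := a))
       (pair_pmf (q (h b)) (Pi_pmf B dflt (\<lambda>b. q (h b))))"
    using insert by simp
  also have "\<dots> = Pi_pmf (insert b B) dflt (\<lambda>b. q (h b))"
    using insert.hyps by (subst Pi_pmf_insert) auto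
  finally show ?case by simp
qed

text \<open>Coordinates outside the image of \<open>h\<close> are integrated out and the remaining
  ones renamed. This isolates one row, one column or one block of the product over the whole
  grid.\<close>

lemma card_Pi_pmf_reindex:
  assumes "finite B" "finite I" "inj_on h B" "h ` B \<subseteq> I"
  shows "map_pmf (\<lambda>x. card {b\<in>B. x (h b)}) (Pi_pmf I dflt q)
       = map_pmf (\<lambda>x. card {b\<in>B. x b}) (Pi_pmf B dflt (\<lambda>b. q (h b)))"
proof -
  have "map_pmf (\<lambda>x. card {b\<in>B. x b}) (Pi_pmf B dflt (\<lambda>b. q (h b)))
      = map_pmf (\<lambda>x. card {b\<in>B. x (h b)}) (Pi_pmf (h ` B) dflt q)"
    using assms by (subst Pi_pmf_reindex[symmetric])
      (auto simp: map_pmf_comp intro!: map_pmf_cong arg_cong[of _ _ card])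
  also have "\<dots> = map_pmf (\<lambda>x. card {b\<in>B. x (h b)}) (Pi_pmf I dflt q)"
    by (subst Pi_pmf_subset[OF \<open>finite I\<close> assms(4)])
      (auto simp: map_pmf_comp intro!: map_pmf_cong arg_cong[of _ _ card])
  finally show ?thesis ..
qed

text \<open>A law on the booleans is determined by its mass at \<open>True\<close>, and mixing
  averages that mass.\<close>

lemma bind_bernoulli_pmf:
  assumes "\<And>l. l \<in> set_pmf P \<Longrightarrow> a l \<in> {0..1}"
  shows "bind_pmf P (\<lambda>l. bernoulli_pmf (a l)) = bernoulli_pmf (measure_pmf.expectation P a)"
    and "measure_pmf.expectation P a \<in> {0..1}"
proof -
  have int: "integrable P a"
    using assms by (intro measure_pmf.integrable_const_bound[where B = 1]) (auto intro!: AE_pmfI)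
  have "0 \<le> measure_pmf.expectation P a"
    using assms by (intro integral_nonneg_AE) (auto intro!: AE_pmfI)
  moreover have "measure_pmf.expectation P a \<le> measure_pmf.expectation P (\<lambda>_. 1)"
    using assms int by (intro integral_mono_AE) (auto intro!: AE_pmfI)
  ultimately show *: "measure_pmf.expectation P a \<in> {0..1}" by simp
  have T: "pmf (bind_pmf P (\<lambda>l. bernoulli_pmf (a l))) True = measure_pmf.expectation P a"
    unfolding pmf_bind using assms by (intro integral_cong_AE) (auto intro!: AE_pmfI)
  have "pmf (bind_pmf P (\<lambda>l. bernoulli_pmf (a l))) b = pmf (bernoulli_pmf (measure_pmf.expectation P a)) b" for b
    using T * by (cases b) (auto simp: pmf_False_conv_True)
  then show "bind_pmf P (\<lambda>l. bernoulli_pmf (a l)) = bernoulli_pmf (measure_pmf.expectation P a)"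
    by (intro pmf_eqI)
qed

text \<open>Averaging over the labels turns independent draws with random parameters into independent
  draws with the averaged parameter.\<close>

lemma binomial_mixture:
  fixes a :: "'l \<Rightarrow> real"
  assumes "finite B" "finite I" "inj_on h B" "h ` B \<subseteq> I"
    and a: "\<And>l. l \<in> set_pmf P \<Longrightarrow> a l \<in> {0..1}"
    and q: "\<And>e b. b \<in> B \<Longrightarrow> q e (h b) = bernoulli_pmf (a (e b))"
  shows "bind_pmf (Pi_pmf B dflt' (\<lambda>_. P)) (\<lambda>e. map_pmf (\<lambda>x. card {b\<in>B. x (h b)}) (Pi_pmf I dflt (q e)))
       = binomial_pmf (card B) (measure_pmf.expectation P a)"
proof -
  have "bind_pmf (Pi_pmf B dflt' (\<lambda>_. P)) (\<lambda>e. map_pmf (\<lambda>x. card {b\<in>B. x (h b)}) (Pi_pmf I dflt (q e)))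
      = bind_pmf (Pi_pmf B dflt' (\<lambda>_. P)) (\<lambda>e. map_pmf (\<lambda>x. card {b\<in>B. x b})
          (Pi_pmf B dflt (\<lambda>b. bernoulli_pmf (a (e b)))))"
    using assms by (intro bind_pmf_cong refl)
      (subst card_Pi_pmf_reindex, auto intro!: map_pmf_cong Pi_pmf_cong)
  \<comment> \<open>Every coordinate depends on its own label only and the labels are independent,
    so mixing over the labels can be done inside the product, coordinate by coordinate.\<close>
  also have "\<dots> = map_pmf (\<lambda>x. card {b\<in>B. x b})
      (Pi_pmf B dflt (\<lambda>b. bind_pmf P (\<lambda>l. bernoulli_pmf (a l))))"
    using assms(1) by (subst Pi_pmf_bind[where d' = dflt']) (auto simp: map_bind_pmf)
  also have "\<dots> = binomial_pmf (card B) (measure_pmf.expectation P a)"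
    using assms(1) bind_bernoulli_pmf[of P a, OF a]
    by (subst binomial_pmf_altdef'[where A = B and dflt = dflt]) simp_all
  finally show ?thesis .
qed

text \<open>The indicators of the label \<open>k\<close> are independent Bernoulli variables with
  parameter \<open>pmf P k\<close>.\<close>

lemma card_label_binomial:
  assumes "finite A"
  shows "map_pmf (\<lambda>c. card {i\<in>A. c i = k}) (Pi_pmf A dflt (\<lambda>_. P)) = binomial_pmf (card A) (pmf P k)"
proof -
  have "map_pmf (\<lambda>l. l = k) P = bernoulli_pmf (pmf P k)"
  proof (rule pmf_eqI)
    fix b
    have T: "pmf (map_pmf (\<lambda>l. l = k) P) True = pmf P k"
    proof -
      have "(\<lambda>l. l = k) -` {True} = {k}" by auto
      then show ?thesis by (simp add: pmf_map measure_pmf_single)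
    qed
    show "pmf (map_pmf (\<lambda>l. l = k) P) b = pmf (bernoulli_pmf (pmf P k)) b"
      using T by (cases b) (auto simp: pmf_False_conv_True pmf_le_1)
  qed
  \<comment> \<open>The default \<open>dflt = k\<close> is the image of \<open>dflt\<close> under
    the map from labels to indicators; with this value the product commutes with the map.\<close>
  then have "binomial_pmf (card A) (pmf P k) =
      map_pmf (\<lambda>f. card {i\<in>A. f i}) (Pi_pmf A (dflt = k) (\<lambda>_. map_pmf (\<lambda>l. l = k) P))"
    using assms by (subst binomial_pmf_altdef'[where A = A and dflt = "dflt = k"]) (auto simp: pmf_le_1)
  also have "\<dots> = map_pmf (\<lambda>c. card {i\<in>A. c i = k}) (Pi_pmf A dflt (\<lambda>_. P))"
    using assms by (subst Pi_pmf_map[where dflt = dflt]) (auto simp: map_pmf_comp o_def)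
  finally show ?thesis ..
qed

text \<open>A conditional bound that is uniform over the support survives averaging. Deviation
  bounds can therefore be proved with some of the labels held fixed.\<close>

lemma prob_bind_pmf_le:
  assumes "\<And>x. x \<in> set_pmf P \<Longrightarrow> measure_pmf.prob (f x) A \<le> b"
  shows "measure_pmf.prob (bind_pmf P f) A \<le> b"
proof -
  have b: "0 \<le> b"
    using assms set_pmf_not_empty[of P] by (metis ex_in_conv measure_nonneg order_trans)
  have "emeasure (bind_pmf P f) A = (\<integral>\<^sup>+x. emeasure (f x) A \<partial>P)"
    by (rule emeasure_bind_pmf)
  also have "\<dots> \<le> (\<integral>\<^sup>+x. ennreal b \<partial>P)"
    using assms by (intro nn_integral_mono_AE)
      (auto intro!: AE_pmfI simp: measure_pmf.emeasure_eq_measure ennreal_leI)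
  also have "\<dots> = ennreal b" by simp
  finally show ?thesis using b by (simp add: measure_pmf.emeasure_eq_measure)
qed

text \<open>Hoeffding's inequality. The strict inequality in the event makes its complement the
  non-strict bound required of a good outcome.\<close>

lemma binomial_deviation:
  assumes "p \<in> {0..1}" "0 < N" "0 \<le> \<epsilon>"
  shows "measure_pmf.prob (binomial_pmf N p) {x. \<epsilon> < \<bar>real x / real N - p\<bar>} \<le> 2 * exp (- 2 * real N * \<epsilon>\<^sup>2)"
proof -
  interpret binomial_distribution N p using assms by unfold_locales
  have "measure_pmf.prob (binomial_pmf N p) {x. \<epsilon> < \<bar>real x / real N - p\<bar>}
    \<le> measure_pmf.prob (binomial_pmf N p) {x. \<bar>real x / real N - p\<bar> \<ge> \<epsilon>}"
    by (intro measure_pmf.finite_measure_mono) auto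
  also have "\<dots> \<le> 2 * exp (- 2 * real N * \<epsilon>\<^sup>2)"
    using prob_abs_ge'[OF assms(2,3)] by simp
  finally show ?thesis .
qed

section \<open>The latent block model in terms of labels\<close>

text \<open>The same model with partitions stored as label functions instead of indicator matrices,
  which turns the partitions and the data into plain product laws.\<close>

definition label_pmf :: "lbm_param \<Rightarrow> nat \<Rightarrow> nat \<Rightarrow> ((nat \<Rightarrow> nat) \<times> (nat \<Rightarrow> nat) \<times> (nat \<times> nat \<Rightarrow> bool)) pmf"
  where "label_pmf \<theta> n d =
     bind_pmf (Pi_pmf {..<n} 0 (\<lambda>_. class_pmf (row_prop \<theta>))) (\<lambda>c.
     bind_pmf (Pi_pmf {..<d} 0 (\<lambda>_. class_pmf (col_prop \<theta>))) (\<lambda>e.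
     map_pmf (\<lambda>x. (c, e, x))
       (Pi_pmf ({..<n} \<times> {..<d}) False (\<lambda>(i, j). bernoulli_pmf (conn \<theta> $$ (c i, e j))))))"

definition label_mat :: "nat \<Rightarrow> nat \<Rightarrow> (nat \<Rightarrow> nat) \<Rightarrow> real mat" where
  "label_mat n g c = mat n g (\<lambda>(i, k). of_bool (c i = k))"

definition bool_mat :: "nat \<Rightarrow> nat \<Rightarrow> (nat \<times> nat \<Rightarrow> bool) \<Rightarrow> real mat" where
  "bool_mat n d x = mat n d (\<lambda>ij. of_bool (x ij))"

lemma set_class_pmf: "prob_vec p \<Longrightarrow> set_pmf (class_pmf p) \<subseteq> {..<dim_vec p}"
  by (auto simp: set_pmf_eq pmf_class_pmf split: if_splits)

lemma labels_in_range:
  fixes n :: nat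
  assumes "prob_vec p" "c \<in> set_pmf (Pi_pmf {..<n} 0 (\<lambda>_. class_pmf p))" "i < n"
  shows "c i < dim_vec p"
  using assms set_class_pmf[of p] by (auto simp: set_Pi_pmf PiE_dflt_def subset_iff)

text \<open>The double sum that gives the Bernoulli parameter in \<open>data_pmf\<close> picks out
  the entry \<open>(c i, e j)\<close> of \<open>conn\<close>. This needs labels within the range of
  the classes, which holds on the support of the label laws.\<close>

lemma lbm_pmf_conv_label_pmf:
  assumes "lbm_parameter g m \<theta>"
  shows "lbm_pmf \<theta> n d =
    map_pmf (\<lambda>(c, e, x). (label_mat n g c, label_mat d m e, bool_mat n d x)) (label_pmf \<theta> n d)"
proof -
  have dims: "dim_vec (row_prop \<theta>) = g" "dim_vec (col_prop \<theta>) = m"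
    "prob_vec (row_prop \<theta>)" "prob_vec (col_prop \<theta>)"
    using assms by (auto simp: lbm_parameter_def)
  have data: "data_pmf \<theta> (label_mat n g c) (label_mat d m e) = map_pmf (bool_mat n d)
      (Pi_pmf ({..<n} \<times> {..<d}) False (\<lambda>(i, j). bernoulli_pmf (conn \<theta> $$ (c i, e j))))"
    if c: "\<And>i. i < n \<Longrightarrow> c i < g" and e: "\<And>j. j < d \<Longrightarrow> e j < m" for c e
  proof -
    have "(\<Sum>k<g. \<Sum>l<m. label_mat n g c $$ (i, k) * label_mat d m e $$ (j, l) * conn \<theta> $$ (k, l))
        = conn \<theta> $$ (c i, e j)" if "i < n" "j < d" for i j
    proof -
      have "(\<Sum>k<g. \<Sum>l<m. label_mat n g c $$ (i, k) * label_mat d m e $$ (j, l) * conn \<theta> $$ (k, l))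
        = (\<Sum>k<g. \<Sum>l<m. if k = c i then if l = e j then conn \<theta> $$ (k, l) else 0 else 0)"
        using that by (intro sum.cong refl) (auto simp: label_mat_def)
      also have "\<dots> = (\<Sum>k<g. if k = c i then \<Sum>l<m. if l = e j then conn \<theta> $$ (k, l) else 0 else 0)"
        by (intro sum.cong refl) auto
      finally show ?thesis using c[OF that(1)] e[OF that(2)] by simp
    qed
    then show ?thesis
      unfolding data_pmf_def
      by (intro map_pmf_cong Pi_pmf_cong) (auto simp: label_mat_def bool_mat_def)
  qed
  show ?thesis
    unfolding lbm_pmf_def label_pmf_def partition_pmf_def map_bind_pmf bind_map_pmf map_pmf_comp dims
    unfolding label_mat_def[symmetric]
    by (intro bind_pmf_cong refl, subst data)
       (use dims in \<open>auto dest!: labels_in_range simp: bind_map_pmf map_pmf_def bind_assoc_pmf bind_return_pmf\<close>)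
qed

section \<open>Label switching\<close>

text \<open>Bridges two orientations: \<open>part_equiv\<close> is applied to the estimate first,
  whereas \<open>switching_perm\<close> describes a switch from the true partition to the
  estimate.\<close>

lemma switches_inv:
  assumes "switches s z z'"
  shows "switches (inv_into UNIV s) z' z"
proof -
  have s: "s permutes {..<dim_col z}" and dims: "dim_row z = dim_row z'" "dim_col z = dim_col z'"
    and eq: "\<And>i k. i < dim_row z \<Longrightarrow> k < dim_col z \<Longrightarrow> z' $$ (i, s k) = z $$ (i, k)"
    using assms by (auto simp: switches_def)
  have s': "inv_into UNIV s permutes {..<dim_col z}" by (rule permutes_inv[OF s])
  have "z $$ (i, inv_into UNIV s k) = z' $$ (i, k)" if "i < dim_row z" "k < dim_col z" for i k
    using eq[of i "inv_into UNIV s k"] that permutes_in_image[OF s', of k] permutes_inverses(1)[OF s] by simp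
  then show ?thesis using s' dims by (auto simp: switches_def)
qed

text \<open>Pull column \<open>s k\<close> of \<open>z\<close> back through \<open>s'\<close>: the
  result is a column \<open>k'\<close> of the label matrix that agrees with column \<open>k\<close>.
  A row labelled \<open>k\<close> has its only \<open>1\<close> in column \<open>k\<close>, hence
  \<open>k' = k\<close>. This is where nonempty classes matter.\<close>

lemma switches_unique:
  assumes "switches s (label_mat n g c) z" "switches s' (label_mat n g c) z"
    and "\<And>k. k < g \<Longrightarrow> \<exists>i<n. c i = k"
  shows "s = s'"
proof
  fix k
  have s: "s permutes {..<g}" and s': "s' permutes {..<g}"
    using assms by (auto simp: switches_def label_mat_def)
  show "s k = s' k"
  proof (cases "k < g")
    case True
    then obtain i where i: "i < n" "c i = k" using assms(3) by auto
    have "s k < g" using True permutes_in_image[OF s, of k] by simp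
    then obtain k' where k': "s' k' = s k" "k' < g"
      using permutes_in_image[OF permutes_inv[OF s'], of "s k"] permutes_inverses(1)[OF s', of "s k"]
      by (metis lessThan_iff)
    have "label_mat n g c $$ (i, k') = label_mat n g c $$ (i, k)"
      using assms(1,2) i k' True unfolding switches_def
      by (metis dim_col_mat(1) dim_row_mat(1) label_mat_def)
    then have "k' = k" using i k' True by (auto simp: label_mat_def split: if_splits)
    then show ?thesis using k' by simp
  next
    case False
    then show ?thesis using permutes_not_in[OF s] permutes_not_in[OF s'] by simp
  qed
qed

lemma switching_perm_eq:
  assumes "switches s (label_mat n g c) z" "\<And>k. k < g \<Longrightarrow> \<exists>i<n. c i = k"
  shows "part_equiv z (label_mat n g c)" "switching_perm z (label_mat n g c) = s"
proof -
  show *: "part_equiv z (label_mat n g c)"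
    using switches_inv[OF assms(1)] by (auto simp: part_equiv_def)
  have "(THE s. switches s (label_mat n g c) z) = s"
  proof (rule the_equality)
    show "switches s (label_mat n g c) z" by (rule assms(1))
    show "s' = s" if "switches s' (label_mat n g c) z" for s'
      using that assms by (rule switches_unique)
  qed
  then show "switching_perm z (label_mat n g c) = s"
    using * by (simp add: switching_perm_def)
qed

text \<open>The estimator is equivariant under relabelling, since each of its coordinates depends
  only on the indicator columns of the classes concerned. After exact recovery it may thus be
  computed from the true partitions.\<close>

lemma permute_block_estimate:
  assumes "switches s z zh" "switches t w wh"
  shows "permute_param s t (block_estimate zh wh X) = block_estimate z w X"
proof -
  have s: "s permutes {..<dim_col z}" and t: "t permutes {..<dim_col w}"
    and dims: "dim_row zh = dim_row z" "dim_col zh = dim_col z" "dim_row wh = dim_row w" "dim_col wh = dim_col w"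
    and z: "\<And>i k. i < dim_row z \<Longrightarrow> k < dim_col z \<Longrightarrow> zh $$ (i, s k) = z $$ (i, k)"
    and w: "\<And>j l. j < dim_row w \<Longrightarrow> l < dim_col w \<Longrightarrow> wh $$ (j, t l) = w $$ (j, l)"
    using assms by (auto simp: switches_def)
  have sk: "s k < dim_col z" if "k < dim_col z" for k using permutes_in_image[OF s, of k] that by simp
  have tl: "t l < dim_col w" if "l < dim_col w" for l using permutes_in_image[OF t, of l] that by simp
  have cz: "class_size zh (s k) = class_size z k" if "k < dim_col z" for k
    using that z by (simp add: class_size_def dims)
  have cw: "class_size wh (t l) = class_size w l" if "l < dim_col w" for l
    using that w by (simp add: class_size_def dims)
  have sums: "(\<Sum>i<dim_row z. \<Sum>j<dim_row w. zh $$ (i, s k) * wh $$ (j, t l) * X $$ (i, j))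
      = (\<Sum>i<dim_row z. \<Sum>j<dim_row w. z $$ (i, k) * w $$ (j, l) * X $$ (i, j))"
    if "k < dim_col z" "l < dim_col w" for k l
    using that z w by (intro sum.cong refl) auto
  show ?thesis
    unfolding permute_param_def block_estimate_def
    by (auto simp: dims sk tl cz cw sums)
qed

section \<open>Correctness of the Largest Gaps algorithm on well-separated rows\<close>

text \<open>In an increasing list the indices of the elements up to \<open>p\<close> form an initial
  segment, so its length locates \<open>p\<close> between two consecutive elements.\<close>

lemma nth_interval_iff_card:
  fixes xs :: "nat list"
  assumes "sorted_wrt (<) xs" "Suc k < length xs"
  shows "xs ! k \<le> p \<and> p < xs ! Suc k \<longleftrightarrow> card {q \<in> set xs. q \<le> p} = Suc k"
proof -
  let ?I = "{i. i < length xs \<and> xs ! i \<le> p}"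
  have mono: "xs ! i < xs ! j" if "i < j" "j < length xs" for i j
    using assms(1) that by (simp add: sorted_wrt_iff_nth_less)
  have "distinct xs" using assms(1) strict_sorted_iff by blast
  have "{q \<in> set xs. q \<le> p} = (!) xs ` ?I" by (auto simp: in_set_conv_nth)
  moreover have "inj_on ((!) xs) ?I" using \<open>distinct xs\<close> by (auto simp: inj_on_def nth_eq_iff_index_eq)
  ultimately have card: "card {q \<in> set xs. q \<le> p} = card ?I" by (simp add: card_image)
  have down: "i \<in> ?I" if "i \<le> j" "j \<in> ?I" for i j
    using that mono[of i j] by (cases "i = j") auto
  show ?thesis
  proof
    assume *: "xs ! k \<le> p \<and> p < xs ! Suc k"
    have "?I = {..k}"
    proof safe
      fix i assume i: "i < length xs" "xs ! i \<le> p"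
      show "i \<le> k"
      proof (rule ccontr)
        assume "\<not> i \<le> k"
        then have "Suc k \<in> ?I" using down[of "Suc k" i] i by auto
        then show False using * by simp
      qed
    next
      fix i assume "i \<le> k"
      then have "i \<in> ?I" using down[of i k] * assms(2) by auto
      then show "i < length xs" "xs ! i \<le> p" by auto
    qed
    then show "card {q \<in> set xs. q \<le> p} = Suc k" using card by simp
  next
    assume c: "card {q \<in> set xs. q \<le> p} = Suc k"
    then have cI: "card ?I = Suc k" using card by simp
    have fin: "finite ?I" by simp
    have "xs ! k \<le> p"
    proof (rule ccontr)
      assume n: "\<not> xs ! k \<le> p"
      have "?I \<subseteq> {..<k}"
      proof
        fix i assume i: "i \<in> ?I"
        show "i \<in> {..<k}"
        proof (rule ccontr)
          assume "i \<notin> {..<k}"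
          then have "k \<in> ?I" using down[of k i] i by simp
          then show False using n by simp
        qed
      qed
      then have "card ?I \<le> k" using card_mono[of "{..<k}" ?I] by simp
      then show False using cI by simp
    qed
    moreover have "p < xs ! Suc k"
    proof (rule ccontr)
      assume "\<not> p < xs ! Suc k"
      then have "Suc k \<in> ?I" using assms(2) by simp
      then have "{..Suc k} \<subseteq> ?I" using down by auto
      then have "Suc (Suc k) \<le> card ?I" using card_mono[OF fin, of "{..Suc k}"] by simp
      then show False using cI by simp
    qed
    ultimately show "xs ! k \<le> p \<and> p < xs ! Suc k" by simp
  qed
qed

text \<open>The estimated class of the row at sorted position \<open>p\<close>, both counted from \<open>0\<close>.\<close>

definition breaks_upto :: "real \<Rightarrow> real mat \<Rightarrow> nat \<Rightarrow> nat" where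
  "breaks_upto S X p = card {q \<in> {1..p}. S < gap X q}"

section \<open>Estimated classes as counts of break points\<close>

lemma lg_classes_eq: "lg_classes S X = Suc (card {q \<in> {1..<dim_row X}. S < gap X q})"
proof -
  have "length (filter (\<lambda>p. gap X p > S) [1..<dim_row X]) = card (set (filter (\<lambda>p. gap X p > S) [1..<dim_row X]))"
    by (intro distinct_card[symmetric]) simp
  also have "set (filter (\<lambda>p. gap X p > S) [1..<dim_row X]) = {q \<in> {1..<dim_row X}. S < gap X q}"
    by auto
  finally show ?thesis by (simp add: lg_classes_def break_points_def)
qed

lemma break_points_interval:
  assumes "p < dim_row X" "k < lg_classes S X"
  shows "break_points S X ! k \<le> p \<and> p < break_points S X ! Suc k \<longleftrightarrow> breaks_upto S X p = k"
proof -
  have "sorted_wrt (<) (break_points S X)"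
    using assms(1) by (auto simp: break_points_def sorted_wrt_append sorted_wrt_filter)
  moreover have "Suc k < length (break_points S X)" using assms(2) by (simp add: lg_classes_def)
  ultimately have "break_points S X ! k \<le> p \<and> p < break_points S X ! Suc k \<longleftrightarrow>
      card {q \<in> set (break_points S X). q \<le> p} = Suc k"
    by (rule nth_interval_iff_card)
  \<comment> \<open>The initial break point \<open>0\<close> always counts, which accounts for the
    \<open>Suc\<close>; the final one, \<open>dim_row X\<close>, never does because \<open>p\<close>
    lies below it.\<close>
  also have "{q \<in> set (break_points S X). q \<le> p} = insert 0 {q \<in> {1..p}. S < gap X q}"
    using assms(1) by (auto simp: break_points_def)
  also have "card \<dots> = Suc (breaks_upto S X p)"
    by (subst card_insert_disjoint) (auto simp: breaks_upto_def)
  finally show ?thesis by simp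
qed

lemma breaks_upto_Suc: "breaks_upto S X (Suc p) = breaks_upto S X p + of_bool (S < gap X (Suc p))"
proof -
  have "{q \<in> {1..Suc p}. S < gap X q} =
      (if S < gap X (Suc p) then insert (Suc p) {q \<in> {1..p}. S < gap X q} else {q \<in> {1..p}. S < gap X q})"
    by (auto simp: le_Suc_eq)
  then show ?thesis by (simp add: breaks_upto_def)
qed

lemma breaks_upto_0: "breaks_upto S X 0 = 0"
  by (simp add: breaks_upto_def)

lemma breaks_upto_mono: "p \<le> q \<Longrightarrow> breaks_upto S X p \<le> breaks_upto S X q"
  unfolding breaks_upto_def by (intro card_mono) auto

text \<open>The count starts at \<open>0\<close> and grows by at most one per position, so no value
  is skipped: every estimated class is nonempty.\<close>

lemma breaks_upto_image:
  assumes "0 < dim_row X"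
  shows "breaks_upto S X ` {..<dim_row X} = {..<lg_classes S X}"
proof -
  have img: "breaks_upto S X ` {..p} = {..breaks_upto S X p}" for p
  proof (induction p)
    case (Suc p)
    then show ?case unfolding atMost_Suc image_insert Suc.IH by (auto simp: breaks_upto_Suc)
  qed (auto simp: breaks_upto_0)
  have "{..<dim_row X} = {..dim_row X - 1}" using assms by auto
  moreover have "lg_classes S X = Suc (breaks_upto S X (dim_row X - 1))"
  proof -
    have "{1..<dim_row X} = {1..dim_row X - 1}" using assms by auto
    then show ?thesis by (simp add: lg_classes_eq breaks_upto_def)
  qed
  ultimately show ?thesis using img by (simp add: lessThan_Suc_atMost)
qed

text \<open>If two rows have the same label exactly when their means are within \<open>S\<close> of each other, then
  labels form intervals in the sorted order and gaps larger than \<open>S\<close> occur exactly at label changes.\<close>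

lemma largest_gaps_correct:
  assumes S: "0 \<le> S" and onto: "c ` {..<dim_row X} = {..<g}" and g: "0 < g"
    and sep: "\<And>i j. i < dim_row X \<Longrightarrow> j < dim_row X \<Longrightarrow>
      c i = c j \<longleftrightarrow> \<bar>row_mean X i - row_mean X j\<bar> \<le> S"
  shows "lg_classes S X = g"
    and "\<exists>s. switches s (label_mat (dim_row X) g c) (lg_partition S X)"
proof -
  let ?n = "dim_row X" and ?L = "sorted_rows X"
  define r where "r p = row_mean X (?L ! p)" for p
  define b where "b = breaks_upto S X"
  have n: "0 < ?n" using onto g by (cases "?n = 0") auto
  have len: "length ?L = ?n" and setL: "set ?L = {..<?n}" and dist: "distinct ?L"
    by (auto simp: sorted_rows_def)
  have Ln: "?L ! p < ?n" if "p < ?n" for p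
    using that len setL nth_mem[of p ?L] by auto
  have mono: "r p \<le> r q" if "p \<le> q" "q < ?n" for p q
  proof -
    have "sorted (map (row_mean X) ?L)" by (simp add: sorted_rows_def)
    then have "map (row_mean X) ?L ! p \<le> map (row_mean X) ?L ! q"
      using that len by (intro sorted_nth_mono) auto
    then show ?thesis using that len by (simp add: r_def)
  qed
  have sepL: "c (?L ! p) = c (?L ! q) \<longleftrightarrow> r q - r p \<le> S" if "p \<le> q" "q < ?n" for p q
    using sep[OF Ln Ln, of p q] that mono[OF that] by (simp add: r_def)
  have bS: "b (Suc p) = b p \<longleftrightarrow> c (?L ! Suc p) = c (?L ! p)" if "Suc p < ?n" for p
    using sepL[of p "Suc p"] that by (auto simp: b_def breaks_upto_Suc gap_def r_def)
  \<comment> \<open>Induction on the right end. If \<open>b\<close> agrees at both ends,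
    monotonicity makes it constant in between; if the labels agree at both ends, the mean at
    position \<open>q\<close> lies between two means at most \<open>S\<close> apart, so that row has
    the same label.\<close>
  have b_iff_le: "b p = b q \<longleftrightarrow> c (?L ! p) = c (?L ! q)" if "p \<le> q" "q < ?n" for p q
    using that
  proof (induction q rule: dec_induct)
    case (step q)
    have bm: "b p \<le> b q" "b q \<le> b (Suc q)"
      using step.hyps by (auto simp: b_def intro!: breaks_upto_mono)
    show ?case
    proof
      assume "b p = b (Suc q)"
      then have "b p = b q" "b (Suc q) = b q" using bm by auto
      then show "c (?L ! p) = c (?L ! Suc q)" using step bS[of q] by simp
    next
      assume c: "c (?L ! p) = c (?L ! Suc q)"
      then have "r (Suc q) - r p \<le> S" using sepL[of p "Suc q"] step by simp
      moreover have "r p \<le> r q" "r q \<le> r (Suc q)" using mono[of p q] mono[of q "Suc q"] step by auto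
      ultimately have "c (?L ! p) = c (?L ! q)" using sepL[of p q] step by simp
      then show "b p = b (Suc q)" using step c bS[of q] by simp
    qed
  qed simp
  have b_iff: "b p = b q \<longleftrightarrow> c (?L ! p) = c (?L ! q)" if "p < ?n" "q < ?n" for p q
    using b_iff_le[of p q] b_iff_le[of q p] that by (cases "p \<le> q") auto
  have b_img: "b ` {..<?n} = {..<lg_classes S X}"
    unfolding b_def by (rule breaks_upto_image[OF n])
  have ex_pos: "\<exists>p<?n. c (?L ! p) = k" if "k < g" for k
  proof -
    from that onto obtain i where "i < ?n" "c i = k" by (metis imageE lessThan_iff)
    then show ?thesis using setL len by (metis in_set_conv_nth lessThan_iff)
  qed
  define pos where "pos k = (SOME p. p < ?n \<and> c (?L ! p) = k)" for k
  have pos: "pos k < ?n" "c (?L ! pos k) = k" if "k < g" for k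
    using someI_ex[OF ex_pos[OF that]] by (auto simp: pos_def)
  have cg: "c i < g" if "i < ?n" for i using onto that by auto
  \<comment> \<open>The estimated class of label \<open>k\<close> is read off a representative row;
    by \<open>b_iff\<close> the choice of the row is immaterial. Outside the labels \<open>s\<close>
    is the identity, as \<open>permutes\<close> demands.\<close>
  define s where "s k = (if k < g then b (pos k) else k)" for k
  have s_b: "s (c (?L ! p)) = b p" if "p < ?n" for p
    using pos[OF cg[OF Ln[OF that]]] cg[OF Ln[OF that]] b_iff[OF _ that] by (auto simp: s_def)
  have bij: "bij_betw s {..<g} {..<lg_classes S X}"
  proof (rule bij_betwI')
    fix k k' assume "k \<in> {..<g}" "k' \<in> {..<g}"
    then show "(s k = s k') = (k = k')"
      using pos[of k] pos[of k'] b_iff[of "pos k" "pos k'"] by (auto simp: s_def)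
  next
    fix k assume "k \<in> {..<g}"
    then show "s k \<in> {..<lg_classes S X}" using pos[of k] b_img by (auto simp: s_def)
  next
    fix y assume "y \<in> {..<lg_classes S X}"
    then obtain p where "p < ?n" "y = b p" using b_img by (metis imageE lessThan_iff)
    then show "\<exists>k\<in>{..<g}. y = s k" using s_b[of p] cg[OF Ln[of p]] by force
  qed
  from bij_betw_same_card[OF bij] show lg: "lg_classes S X = g" by simp
  have "s permutes {..<g}"
    using bij by (intro bij_imp_permutes) (auto simp: lg s_def)
  moreover have "lg_partition S X $$ (i, s k) = label_mat ?n g c $$ (i, k)" if i: "i < ?n" "k < g" for i k
  proof -
    obtain p where p: "p < ?n" "?L ! p = i" using i setL len by (metis in_set_conv_nth lessThan_iff)
    have sk: "s k < g" using bij i by (auto simp: bij_betw_def lg)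
    \<comment> \<open>The existential quantifier in \<open>lg_partition\<close> does not bound the
      sorted position; this bound keeps it inside the list.\<close>
    have last: "break_points S X ! Suc (s k) \<le> ?n"
    proof -
      have "break_points S X ! Suc (s k) \<in> set (break_points S X)"
        using sk lg by (intro nth_mem) (auto simp: lg_classes_def)
      then show ?thesis by (auto simp: break_points_def)
    qed
    have "(\<exists>q. break_points S X ! s k \<le> q \<and> q < break_points S X ! Suc (s k) \<and> ?L ! q = i)
        \<longleftrightarrow> (\<exists>q<?n. break_points S X ! s k \<le> q \<and> q < break_points S X ! Suc (s k) \<and> ?L ! q = i)"
      using last by (metis order_less_le_trans)
    also have "\<dots> \<longleftrightarrow> (\<exists>q<?n. b q = s k \<and> ?L ! q = i)"
      using break_points_interval[of _ X "s k" S] sk lg by (auto simp: b_def)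
    also have "\<dots> \<longleftrightarrow> b p = s k"
      using p dist len by (metis nth_eq_iff_index_eq)
    also have "\<dots> \<longleftrightarrow> c i = k"
      using s_b[OF p(1)] p bij cg[OF i(1)] i by (auto simp: bij_betw_def inj_on_def)
    finally show ?thesis using i sk by (simp add: lg_partition_def label_mat_def lg)
  qed
  ultimately have "switches s (label_mat ?n g c) (lg_partition S X)"
    by (auto simp: switches_def label_mat_def lg_partition_def lg)
  then show "\<exists>s. switches s (label_mat ?n g c) (lg_partition S X)" by blast
qed

section \<open>Deviation bounds\<close>

lemma class_pmf_expectation:
  assumes "prob_vec p"
  shows "measure_pmf.expectation (class_pmf p) a = (\<Sum>l<dim_vec p. p $ l * a l)"
  using set_class_pmf[OF assms]
  by (subst integral_measure_pmf[of "{..<dim_vec p}"]) (auto simp: pmf_class_pmf[OF assms])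

definition block :: "nat \<Rightarrow> nat \<Rightarrow> (nat \<Rightarrow> nat) \<Rightarrow> (nat \<Rightarrow> nat) \<Rightarrow> nat \<Rightarrow> nat \<Rightarrow> (nat \<times> nat) set" where
  "block n d c e k l = {i\<in>{..<n}. c i = k} \<times> {j\<in>{..<d}. e j = l}"

context
  fixes g m :: nat and \<theta> :: lbm_param
  assumes par: "lbm_parameter g m \<theta>"
begin

lemma par_dims:
  "dim_vec (row_prop \<theta>) = g" "dim_vec (col_prop \<theta>) = m"
  "dim_row (conn \<theta>) = g" "dim_col (conn \<theta>) = m"
  "prob_vec (row_prop \<theta>)" "prob_vec (col_prop \<theta>)"
  using par by (auto simp: lbm_parameter_def)

lemma conn_bounds: "k < g \<Longrightarrow> l < m \<Longrightarrow> conn \<theta> $$ (k, l) \<in> {0..1}"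
  using par by (auto simp: lbm_parameter_def)

lemma row_class_lt: "k \<in> set_pmf (class_pmf (row_prop \<theta>)) \<Longrightarrow> k < g"
  using set_class_pmf[OF par_dims(5)] par_dims by auto

lemma col_class_lt: "l \<in> set_pmf (class_pmf (col_prop \<theta>)) \<Longrightarrow> l < m"
  using set_class_pmf[OF par_dims(6)] par_dims by auto

section \<open>Deviations of row and column means\<close>

text \<open>With the row labels fixed and the column labels averaged out, the number of ones in row
  \<open>i\<close> is binomial with parameter \<open>tau \<theta> (c i)\<close>. The resulting bound
  does not depend on the row labels, so it holds unconditionally.\<close>

lemma row_mean_deviation:
  assumes "i < n" "0 < d" "0 \<le> \<epsilon>"
  shows "measure_pmf.prob (label_pmf \<theta> n d)
      {(c, e, x). \<epsilon> < \<bar>real (card {j\<in>{..<d}. x (i, j)}) / real d - tau \<theta> (c i)\<bar>} \<le> 2 * exp (- 2 * real d * \<epsilon>\<^sup>2)"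
    (is "measure_pmf.prob _ ?A \<le> _")
  unfolding label_pmf_def
proof (rule prob_bind_pmf_le)
  fix c assume "c \<in> set_pmf (Pi_pmf {..<n} 0 (\<lambda>_. class_pmf (row_prop \<theta>)))"
  then have ci: "c i < g" using labels_in_range[OF par_dims(5)] assms(1) par_dims(1) by blast
  let ?Q = "\<lambda>e. Pi_pmf ({..<n} \<times> {..<d}) False (\<lambda>(i, j). bernoulli_pmf (conn \<theta> $$ (c i, e j)))"
  let ?M = "bind_pmf (Pi_pmf {..<d} 0 (\<lambda>_. class_pmf (col_prop \<theta>))) (\<lambda>e. map_pmf (\<lambda>x. (c, e, x)) (?Q e))"
  let ?f = "\<lambda>(c :: nat \<Rightarrow> nat, e :: nat \<Rightarrow> nat, x). card {j\<in>{..<d}. x (i, j)}"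
  have a: "\<And>l. l \<in> set_pmf (class_pmf (col_prop \<theta>)) \<Longrightarrow> conn \<theta> $$ (c i, l) \<in> {0..1}"
    using conn_bounds[OF ci col_class_lt] .
  have tau: "measure_pmf.expectation (class_pmf (col_prop \<theta>)) (\<lambda>l. conn \<theta> $$ (c i, l)) = tau \<theta> (c i)"
    by (simp add: class_pmf_expectation[OF par_dims(6)] tau_def mult.commute)
  have "map_pmf ?f ?M = bind_pmf (Pi_pmf {..<d} 0 (\<lambda>_. class_pmf (col_prop \<theta>)))
      (\<lambda>e. map_pmf (\<lambda>x. card {j\<in>{..<d}. x (i, j)}) (?Q e))"
    by (simp add: map_bind_pmf map_pmf_comp)
  also have "\<dots> = binomial_pmf (card {..<d}) (measure_pmf.expectation (class_pmf (col_prop \<theta>)) (\<lambda>l. conn \<theta> $$ (c i, l)))"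
    using assms a by (intro binomial_mixture) (auto simp: inj_on_def)
  finally have bin: "map_pmf ?f ?M = binomial_pmf d (tau \<theta> (c i))" by (simp add: tau)
  have "measure_pmf.prob ?M ?A \<le> measure_pmf.prob ?M (?f -` {k. \<epsilon> < \<bar>real k / real d - tau \<theta> (c i)\<bar>})"
    by (intro measure_pmf.finite_measure_mono_AE AE_pmfI) auto
  also have "\<dots> = measure_pmf.prob (binomial_pmf d (tau \<theta> (c i))) {k. \<epsilon> < \<bar>real k / real d - tau \<theta> (c i)\<bar>}"
    unfolding bin[symmetric] by simp
  also have "\<dots> \<le> 2 * exp (- 2 * real d * \<epsilon>\<^sup>2)"
    using assms bind_bernoulli_pmf(2)[of "class_pmf (col_prop \<theta>)" "\<lambda>l. conn \<theta> $$ (c i, l)", OF a] tau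
    by (intro binomial_deviation) auto
  finally show "measure_pmf.prob ?M ?A \<le> 2 * exp (- 2 * real d * \<epsilon>\<^sup>2)" .
qed

lemma col_mean_deviation:
  assumes "j < d" "0 < n" "0 \<le> \<epsilon>"
  shows "measure_pmf.prob (label_pmf \<theta> n d)
      {(c, e, x). \<epsilon> < \<bar>real (card {i\<in>{..<n}. x (i, j)}) / real n - xi \<theta> (e j)\<bar>} \<le> 2 * exp (- 2 * real n * \<epsilon>\<^sup>2)"
    (is "measure_pmf.prob _ ?A \<le> _")
  unfolding label_pmf_def
\<comment> \<open>The two label draws are independent; exchanging them allows the column labels to
  be fixed first and the row labels to be averaged out.\<close>
proof (subst bind_commute_pmf, rule prob_bind_pmf_le)
  fix e assume "e \<in> set_pmf (Pi_pmf {..<d} 0 (\<lambda>_. class_pmf (col_prop \<theta>)))"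
  then have ej: "e j < m" using labels_in_range[OF par_dims(6)] assms(1) par_dims(2) by blast
  let ?Q = "\<lambda>c. Pi_pmf ({..<n} \<times> {..<d}) False (\<lambda>(i, j). bernoulli_pmf (conn \<theta> $$ (c i, e j)))"
  let ?M = "bind_pmf (Pi_pmf {..<n} 0 (\<lambda>_. class_pmf (row_prop \<theta>))) (\<lambda>c. map_pmf (\<lambda>x. (c, e, x)) (?Q c))"
  let ?f = "\<lambda>(c :: nat \<Rightarrow> nat, e :: nat \<Rightarrow> nat, x). card {i\<in>{..<n}. x (i, j)}"
  have a: "\<And>k. k \<in> set_pmf (class_pmf (row_prop \<theta>)) \<Longrightarrow> conn \<theta> $$ (k, e j) \<in> {0..1}"
    using conn_bounds[OF row_class_lt ej] .
  have xi: "measure_pmf.expectation (class_pmf (row_prop \<theta>)) (\<lambda>k. conn \<theta> $$ (k, e j)) = xi \<theta> (e j)"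
    by (simp add: class_pmf_expectation[OF par_dims(5)] xi_def)
  have "map_pmf ?f ?M = bind_pmf (Pi_pmf {..<n} 0 (\<lambda>_. class_pmf (row_prop \<theta>)))
      (\<lambda>c. map_pmf (\<lambda>x. card {i\<in>{..<n}. x (i, j)}) (?Q c))"
    by (simp add: map_bind_pmf map_pmf_comp)
  also have "\<dots> = binomial_pmf (card {..<n}) (measure_pmf.expectation (class_pmf (row_prop \<theta>)) (\<lambda>k. conn \<theta> $$ (k, e j)))"
    using assms a by (intro binomial_mixture[where h = "\<lambda>i. (i, j)"]) (auto simp: inj_on_def)
  finally have bin: "map_pmf ?f ?M = binomial_pmf n (xi \<theta> (e j))" by (simp add: xi)
  have "measure_pmf.prob ?M ?A \<le> measure_pmf.prob ?M (?f -` {k. \<epsilon> < \<bar>real k / real n - xi \<theta> (e j)\<bar>})"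
    by (intro measure_pmf.finite_measure_mono_AE AE_pmfI) auto
  also have "\<dots> = measure_pmf.prob (binomial_pmf n (xi \<theta> (e j))) {k. \<epsilon> < \<bar>real k / real n - xi \<theta> (e j)\<bar>}"
    unfolding bin[symmetric] by simp
  also have "\<dots> \<le> 2 * exp (- 2 * real n * \<epsilon>\<^sup>2)"
    using assms bind_bernoulli_pmf(2)[of "class_pmf (row_prop \<theta>)" "\<lambda>k. conn \<theta> $$ (k, e j)", OF a] xi
    by (intro binomial_deviation) auto
  finally show "measure_pmf.prob ?M ?A \<le> 2 * exp (- 2 * real n * \<epsilon>\<^sup>2)" .
qed

section \<open>Deviations of class proportions and block means\<close>

lemma map_fst_label_pmf:
  "map_pmf fst (label_pmf \<theta> n d) = Pi_pmf {..<n} 0 (\<lambda>_. class_pmf (row_prop \<theta>))"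
  by (simp add: label_pmf_def map_bind_pmf map_pmf_comp map_pmf_const bind_return_pmf')

lemma map_snd_label_pmf:
  "map_pmf (\<lambda>(c, e, x). e) (label_pmf \<theta> n d) = Pi_pmf {..<d} 0 (\<lambda>_. class_pmf (col_prop \<theta>))"
  by (simp add: label_pmf_def map_bind_pmf map_pmf_comp map_pmf_const bind_return_pmf')

lemma row_class_deviation:
  assumes "k < g" "0 < n" "0 \<le> \<epsilon>"
  shows "measure_pmf.prob (label_pmf \<theta> n d)
      {(c, e, x). \<epsilon> < \<bar>real (card {i\<in>{..<n}. c i = k}) / real n - row_prop \<theta> $ k\<bar>} \<le> 2 * exp (- 2 * real n * \<epsilon>\<^sup>2)"
    (is "measure_pmf.prob _ ?A \<le> _")
proof -
  have p: "pmf (class_pmf (row_prop \<theta>)) k = row_prop \<theta> $ k"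
    using assms par_dims by (simp add: pmf_class_pmf)
  have "?A = fst -` ((\<lambda>c. card {i\<in>{..<n}. c i = k}) -` {N. \<epsilon> < \<bar>real N / real n - row_prop \<theta> $ k\<bar>})"
    by auto
  then have "measure_pmf.prob (label_pmf \<theta> n d) ?A
      = measure_pmf.prob (map_pmf (\<lambda>c. card {i\<in>{..<n}. c i = k}) (map_pmf fst (label_pmf \<theta> n d)))
          {N. \<epsilon> < \<bar>real N / real n - row_prop \<theta> $ k\<bar>}"
    by (simp only: measure_map_pmf)
  also have "\<dots> \<le> 2 * exp (- 2 * real n * \<epsilon>\<^sup>2)"
    unfolding map_fst_label_pmf card_label_binomial[OF finite_lessThan] p[symmetric] card_lessThan
    using assms by (intro binomial_deviation) (auto simp: pmf_le_1)
  finally show ?thesis .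
qed

lemma col_class_deviation:
  assumes "l < m" "0 < d" "0 \<le> \<epsilon>"
  shows "measure_pmf.prob (label_pmf \<theta> n d)
      {(c, e, x). \<epsilon> < \<bar>real (card {j\<in>{..<d}. e j = l}) / real d - col_prop \<theta> $ l\<bar>} \<le> 2 * exp (- 2 * real d * \<epsilon>\<^sup>2)"
    (is "measure_pmf.prob _ ?A \<le> _")
proof -
  have p: "pmf (class_pmf (col_prop \<theta>)) l = col_prop \<theta> $ l"
    using assms par_dims by (simp add: pmf_class_pmf)
  have "?A = (\<lambda>(c, e, x). e) -` ((\<lambda>e. card {j\<in>{..<d}. e j = l}) -` {N. \<epsilon> < \<bar>real N / real d - col_prop \<theta> $ l\<bar>})"
    by auto
  then have "measure_pmf.prob (label_pmf \<theta> n d) ?A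
      = measure_pmf.prob (map_pmf (\<lambda>e. card {j\<in>{..<d}. e j = l}) (map_pmf (\<lambda>(c, e, x). e) (label_pmf \<theta> n d)))
          {N. \<epsilon> < \<bar>real N / real d - col_prop \<theta> $ l\<bar>}"
    by (simp only: measure_map_pmf)
  also have "\<dots> \<le> 2 * exp (- 2 * real d * \<epsilon>\<^sup>2)"
    unfolding map_snd_label_pmf card_label_binomial[OF finite_lessThan] p[symmetric] card_lessThan
    using assms by (intro binomial_deviation) (auto simp: pmf_le_1)
  finally show ?thesis .
qed

text \<open>Given all labels, the entries of a block are independent with common parameter
  \<open>conn \<theta> $$ (k, l)\<close>. The block size is itself random, so the event includes a
  deterministic lower bound \<open>N0\<close> on it, which replaces the size in the
  exponent.\<close>

lemma block_mean_deviation: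
  assumes "k < g" "l < m" "0 < N0" "0 \<le> \<epsilon>"
  shows "measure_pmf.prob (label_pmf \<theta> n d)
      {(c, e, x). N0 \<le> real (card (block n d c e k l)) \<and>
         \<epsilon> < \<bar>real (card {b\<in>block n d c e k l. x b}) / real (card (block n d c e k l)) - conn \<theta> $$ (k, l)\<bar>}
    \<le> 2 * exp (- 2 * N0 * \<epsilon>\<^sup>2)"
    (is "measure_pmf.prob _ ?A \<le> _")
  unfolding label_pmf_def
proof (intro prob_bind_pmf_le)
  fix c e
  let ?B = "block n d c e k l"
  let ?Q = "Pi_pmf ({..<n} \<times> {..<d}) False (\<lambda>(i, j). bernoulli_pmf (conn \<theta> $$ (c i, e j)))"
  show "measure_pmf.prob (map_pmf (\<lambda>x. (c, e, x)) ?Q) ?A \<le> 2 * exp (- 2 * N0 * \<epsilon>\<^sup>2)"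
  proof (cases "N0 \<le> real (card ?B)")
    \<comment> \<open>A block that is too small lies outside the event, whose conditional
      probability is then zero.\<close>
    case False
    then have "(\<lambda>x. (c, e, x)) -` ?A = {}" by auto
    then show ?thesis by (simp only: measure_map_pmf) simp
  next
    case True
    have B: "finite ?B" "?B \<subseteq> {..<n} \<times> {..<d}" by (auto simp: block_def)
    have "map_pmf (\<lambda>x. card {b\<in>?B. x b}) ?Q =
        map_pmf (\<lambda>x. card {b\<in>?B. x b}) (Pi_pmf ?B False (\<lambda>(i, j). bernoulli_pmf (conn \<theta> $$ (c i, e j))))"
      using card_Pi_pmf_reindex[OF B(1), of "{..<n} \<times> {..<d}" "\<lambda>b. b"] B(2) by simp
    also have "\<dots> = map_pmf (\<lambda>x. card {b\<in>?B. x b}) (Pi_pmf ?B False (\<lambda>_. bernoulli_pmf (conn \<theta> $$ (k, l))))"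
      using B(1) by (intro map_pmf_cong Pi_pmf_cong) (auto simp: block_def)
    also have "\<dots> = binomial_pmf (card ?B) (conn \<theta> $$ (k, l))"
      using B(1) conn_bounds[OF assms(1,2)] by (intro binomial_pmf_altdef'[symmetric]) auto
    finally have bin: "map_pmf (\<lambda>x. card {b\<in>?B. x b}) ?Q = binomial_pmf (card ?B) (conn \<theta> $$ (k, l))" .
    have "(\<lambda>x. (c, e, x)) -` ?A = (\<lambda>x. card {b\<in>?B. x b}) -`
        {N. \<epsilon> < \<bar>real N / real (card ?B) - conn \<theta> $$ (k, l)\<bar>}"
      using True by auto
    then have "measure_pmf.prob (map_pmf (\<lambda>x. (c, e, x)) ?Q) ?A =
        measure_pmf.prob (map_pmf (\<lambda>x. card {b\<in>?B. x b}) ?Q)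
          {N. \<epsilon> < \<bar>real N / real (card ?B) - conn \<theta> $$ (k, l)\<bar>}"
      by (simp only: measure_map_pmf)
    also have "\<dots> \<le> 2 * exp (- 2 * real (card ?B) * \<epsilon>\<^sup>2)"
      unfolding bin using conn_bounds[OF assms(1,2)] True assms by (intro binomial_deviation) auto
    also have "\<dots> \<le> 2 * exp (- 2 * N0 * \<epsilon>\<^sup>2)"
      using True by (simp add: mult_right_mono)
    finally show ?thesis .
  qed
qed

lemma label_pmf_range:
  assumes "(c, e, x) \<in> set_pmf (label_pmf \<theta> n d)"
  shows "\<And>i. i < n \<Longrightarrow> c i < g" "\<And>j. j < d \<Longrightarrow> e j < m"
  using assms labels_in_range[OF par_dims(5)] labels_in_range[OF par_dims(6)] par_dims(1,2)
  by (fastforce simp: label_pmf_def)+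

end

section \<open>Statistics of a labelled data matrix\<close>

lemma row_mean_bool_mat:
  "i < n \<Longrightarrow> row_mean (bool_mat n d x) i = real (card {j\<in>{..<d}. x (i, j)}) / real d"
proof -
  assume i: "i < n"
  have "(\<Sum>j<d. of_bool (x (i, j))) = real (card {j\<in>{..<d}. x (i, j)})"
    by (simp add: sum_of_bool_eq Int_def)
  then show ?thesis using i by (simp add: row_mean_def bool_mat_def)
qed

lemma transpose_bool_mat: "transpose_mat (bool_mat n d x) = bool_mat d n (\<lambda>(j, i). x (i, j))"
  by (intro eq_matI) (auto simp: bool_mat_def)

lemma class_size_label_mat:
  "k < g \<Longrightarrow> class_size (label_mat n g c) k = real (card {i\<in>{..<n}. c i = k})"
  by (simp add: class_size_def label_mat_def sum_of_bool_eq Int_def)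

lemma block_sum_label_mat:
  assumes "k < g" "l < m"
  shows "(\<Sum>i<n. \<Sum>j<d. label_mat n g c $$ (i, k) * label_mat d m e $$ (j, l) * bool_mat n d x $$ (i, j))
    = real (card {b\<in>block n d c e k l. x b})"
proof -
  have "(\<Sum>i<n. \<Sum>j<d. label_mat n g c $$ (i, k) * label_mat d m e $$ (j, l) * bool_mat n d x $$ (i, j))
    = (\<Sum>i<n. \<Sum>j<d. of_bool ((i, j) \<in> block n d c e k l \<and> x (i, j)))"
    using assms by (intro sum.cong refl) (auto simp: label_mat_def bool_mat_def block_def)
  also have "\<dots> = (\<Sum>b\<in>{..<n} \<times> {..<d}. of_bool (b \<in> block n d c e k l \<and> x b))"
    unfolding sum.cartesian_product by (rule sum.cong) auto
  also have "\<dots> = real (card (({..<n} \<times> {..<d}) \<inter> {b. b \<in> block n d c e k l \<and> x b}))"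
    by (subst sum_of_bool_eq) auto
  also have "({..<n} \<times> {..<d}) \<inter> {b. b \<in> block n d c e k l \<and> x b} = {b\<in>block n d c e k l. x b}"
    by (auto simp: block_def)
  finally show ?thesis .
qed

lemma card_block:
  "card (block n d c e k l) = card {i\<in>{..<n}. c i = k} * card {j\<in>{..<d}. e j = l}"
  by (simp add: block_def card_cartesian_product)

text \<open>Means with the same label differ by at most \<open>S / 2 + S / 2 = S\<close>, means with
  different labels by more than \<open>2 * S - S = S\<close>; this is the separation that
  \<open>largest_gaps_correct\<close> asks for. The centres \<open>u\<close> stand for
  \<open>tau \<theta>\<close> when applied to rows and for \<open>xi \<theta>\<close> when applied
  to columns.\<close>

lemma largest_gaps_labels:
  assumes "0 < S" "0 < g"
    and c: "\<And>i. i < n \<Longrightarrow> c i < g" and onto: "\<And>k. k < g \<Longrightarrow> \<exists>i<n. c i = k"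
    and sep: "\<And>k k'. k < g \<Longrightarrow> k' < g \<Longrightarrow> k \<noteq> k' \<Longrightarrow> 2 * S < \<bar>u k - u k'\<bar>"
    and dev: "\<And>i. i < n \<Longrightarrow> \<bar>real (card {j\<in>{..<d}. x (i, j)}) / real d - u (c i)\<bar> \<le> S / 2"
  shows "lg_classes S (bool_mat n d x) = g"
    and "\<exists>s. switches s (label_mat n g c) (lg_partition S (bool_mat n d x))"
proof -
  let ?X = "bool_mat n d x"
  have dim: "dim_row ?X = n" by (simp add: bool_mat_def)
  have img: "c ` {..<dim_row ?X} = {..<g}" using c onto by (fastforce simp: dim)
  have iff: "c i = c j \<longleftrightarrow> \<bar>row_mean ?X i - row_mean ?X j\<bar> \<le> S" if "i < dim_row ?X" "j < dim_row ?X" for i j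
  proof -
    have i: "i < n" and j: "j < n" using that dim by auto
    have di: "\<bar>row_mean ?X i - u (c i)\<bar> \<le> S / 2" and dj: "\<bar>row_mean ?X j - u (c j)\<bar> \<le> S / 2"
      using dev[OF i] dev[OF j] i j by (simp_all add: row_mean_bool_mat)
    show ?thesis
    proof (cases "c i = c j")
      case True
      have "\<bar>row_mean ?X i - row_mean ?X j\<bar> \<le> S"
        using di[unfolded True] dj by arith
      then show ?thesis using True by simp
    next
      case False
      then have "2 * S < \<bar>u (c i) - u (c j)\<bar>" using sep c i j by blast
      then show ?thesis using di dj False \<open>0 < S\<close> by (auto simp: abs_if split: if_splits)
    qed
  qed
  show "lg_classes S ?X = g"
    using assms(1,2) by (intro largest_gaps_correct(1)[OF _ img _ iff]) auto
  show "\<exists>s. switches s (label_mat n g c) (lg_partition S ?X)"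
    using assms(1,2) largest_gaps_correct(2)[OF _ img _ iff] by (simp add: dim)
qed

text \<open>Since \<open>\<eta>\<close> is at most half of every class probability, a deviation of \<open>\<eta>\<close> in the class proportions
  leaves no class empty and at least \<open>n d \<eta>\<^sup>2\<close> entries in each block.\<close>

lemma largest_gaps_good_event:
  fixes c e :: "nat \<Rightarrow> nat" and x :: "nat \<times> nat \<Rightarrow> bool"
  assumes par: "lbm_parameter g m \<theta>" and pos: "0 < g" "0 < m" "0 < n" "0 < d" "0 < Sg" "0 < Sm" "0 < t"
    and c: "\<And>i. i < n \<Longrightarrow> c i < g" and e: "\<And>j. j < d \<Longrightarrow> e j < m"
    and \<eta>: "\<eta> \<le> t" "0 < \<eta>" "\<And>k. k < g \<Longrightarrow> 2 * \<eta> \<le> row_prop \<theta> $ k" "\<And>l. l < m \<Longrightarrow> 2 * \<eta> \<le> col_prop \<theta> $ l"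
    and sepg: "\<And>k k'. k < g \<Longrightarrow> k' < g \<Longrightarrow> k \<noteq> k' \<Longrightarrow> 2 * Sg < \<bar>tau \<theta> k - tau \<theta> k'\<bar>"
    and sepm: "\<And>l l'. l < m \<Longrightarrow> l' < m \<Longrightarrow> l \<noteq> l' \<Longrightarrow> 2 * Sm < \<bar>xi \<theta> l - xi \<theta> l'\<bar>"
    and row: "\<And>i. i < n \<Longrightarrow> \<bar>real (card {j\<in>{..<d}. x (i, j)}) / real d - tau \<theta> (c i)\<bar> \<le> Sg / 2"
    and col: "\<And>j. j < d \<Longrightarrow> \<bar>real (card {i\<in>{..<n}. x (i, j)}) / real n - xi \<theta> (e j)\<bar> \<le> Sm / 2"
    and rowc: "\<And>k. k < g \<Longrightarrow> \<bar>real (card {i\<in>{..<n}. c i = k}) / real n - row_prop \<theta> $ k\<bar> \<le> \<eta>"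
    and colc: "\<And>l. l < m \<Longrightarrow> \<bar>real (card {j\<in>{..<d}. e j = l}) / real d - col_prop \<theta> $ l\<bar> \<le> \<eta>"
    and blk: "\<And>k l. k < g \<Longrightarrow> l < m \<Longrightarrow> real n * real d * \<eta>\<^sup>2 \<le> real (card (block n d c e k l)) \<Longrightarrow>
      \<bar>real (card {b\<in>block n d c e k l. x b}) / real (card (block n d c e k l)) - conn \<theta> $$ (k, l)\<bar> \<le> t"
  defines "z \<equiv> label_mat n g c" and "w \<equiv> label_mat d m e" and "X \<equiv> bool_mat n d x"
  shows "g_hat Sg X = g" "m_hat Sm X = m" "part_equiv (z_hat Sg X) z" "part_equiv (w_hat Sm X) w"
    and "dinf (permute_param (switching_perm (z_hat Sg X) z) (switching_perm (w_hat Sm X) w)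
                (theta_hat Sg Sm X)) \<theta> \<le> ereal t"
proof -
  have cardz: "real n * \<eta> \<le> real (card {i\<in>{..<n}. c i = k})" if "k < g" for k
  proof -
    have "\<eta> \<le> real (card {i\<in>{..<n}. c i = k}) / real n"
      using rowc[OF that] \<eta>(3)[OF that] by linarith
    then show ?thesis using pos by (simp add: field_simps)
  qed
  have cardw: "real d * \<eta> \<le> real (card {j\<in>{..<d}. e j = l})" if "l < m" for l
  proof -
    have "\<eta> \<le> real (card {j\<in>{..<d}. e j = l}) / real d"
      using colc[OF that] \<eta>(4)[OF that] by linarith
    then show ?thesis using pos by (simp add: field_simps)
  qed
  have ontoz: "\<exists>i<n. c i = k" if "k < g" for k
  proof (rule ccontr)
    assume "\<not> (\<exists>i<n. c i = k)"
    then have empty: "{i\<in>{..<n}. c i = k} = {}" by auto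
    have "real n * \<eta> \<le> 0" using cardz[OF that] unfolding empty by simp
    then show False using pos \<eta>(2) by (simp add: mult_le_0_iff)
  qed
  have ontow: "\<exists>j<d. e j = l" if "l < m" for l
  proof (rule ccontr)
    assume "\<not> (\<exists>j<d. e j = l)"
    then have empty: "{j\<in>{..<d}. e j = l} = {}" by auto
    have "real d * \<eta> \<le> 0" using cardw[OF that] unfolding empty by simp
    then show False using pos \<eta>(2) by (simp add: mult_le_0_iff)
  qed
  show "g_hat Sg X = g"
    unfolding g_hat_def X_def
    by (rule largest_gaps_labels(1)[where u = "tau \<theta>" and c = c]) (use pos c ontoz sepg row in auto)
  obtain s where s: "switches s z (z_hat Sg X)"
    using largest_gaps_labels(2)[OF pos(5,1) c ontoz sepg row] unfolding z_def X_def z_hat_def by blast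
  \<comment> \<open>The columns are clustered as rows of the transposed matrix; this is
    \<open>col\<close> in the matching form.\<close>
  have colT: "\<bar>real (card {i\<in>{..<n}. (\<lambda>(j, i). x (i, j)) (j, i)}) / real n - xi \<theta> (e j)\<bar> \<le> Sm / 2" if "j < d" for j
    using col[OF that] by simp
  show "m_hat Sm X = m"
    unfolding m_hat_def X_def transpose_bool_mat
    by (rule largest_gaps_labels(1)[OF pos(6,2) e ontow sepm colT])
  obtain t' where t': "switches t' w (w_hat Sm X)"
    using largest_gaps_labels(2)[OF pos(6,2) e ontow sepm colT]
    unfolding w_def X_def w_hat_def transpose_bool_mat by blast
  show "part_equiv (z_hat Sg X) z" "part_equiv (w_hat Sm X) w"
    using switching_perm_eq(1)[OF s[unfolded z_def] ontoz] switching_perm_eq(1)[OF t'[unfolded w_def] ontow]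
    by (simp_all add: z_def w_def)
  have perms: "switching_perm (z_hat Sg X) z = s" "switching_perm (w_hat Sm X) w = t'"
    using switching_perm_eq(2)[OF s[unfolded z_def] ontoz] switching_perm_eq(2)[OF t'[unfolded w_def] ontow]
    by (simp_all add: z_def w_def)
  have "permute_param (switching_perm (z_hat Sg X) z) (switching_perm (w_hat Sm X) w) (theta_hat Sg Sm X)
      = block_estimate z w X"
    unfolding perms theta_hat_def by (rule permute_block_estimate[OF s t'])
  moreover have "dinf (block_estimate z w X) \<theta> \<le> ereal t"
  proof -
    let ?E = "block_estimate z w X"
    have dims: "dim_vec (row_prop ?E) = g" "dim_vec (col_prop ?E) = m"
      "dim_vec (row_prop \<theta>) = g" "dim_vec (col_prop \<theta>) = m"
      using par_dims[OF par] by (auto simp: block_estimate_def z_def w_def label_mat_def)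
    have r: "\<bar>row_prop ?E $ k - row_prop \<theta> $ k\<bar> \<le> t" if "k < g" for k
    proof -
      have "row_prop ?E $ k = real (card {i\<in>{..<n}. c i = k}) / real n"
        using that class_size_label_mat[OF that] by (simp add: block_estimate_def z_def label_mat_def)
      then show ?thesis using rowc[OF that] \<eta>(1) by simp
    qed
    have cl: "\<bar>col_prop ?E $ l - col_prop \<theta> $ l\<bar> \<le> t" if "l < m" for l
    proof -
      have "col_prop ?E $ l = real (card {j\<in>{..<d}. e j = l}) / real d"
        using that class_size_label_mat[OF that] by (simp add: block_estimate_def w_def label_mat_def)
      then show ?thesis using colc[OF that] \<eta>(1) by simp
    qed
    have k: "\<bar>conn ?E $$ (k, l) - conn \<theta> $$ (k, l)\<bar> \<le> t" if kl: "k < g" "l < m" for k l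
    proof -
      have dz: "dim_row z = n" "dim_col z = g" "dim_row w = d" "dim_col w = m"
        by (auto simp: z_def w_def label_mat_def)
      have "conn ?E $$ (k, l) = real (card {b\<in>block n d c e k l. x b}) / real (card (block n d c e k l))"
        using kl class_size_label_mat[OF kl(1), of n c] class_size_label_mat[OF kl(2), of d e]
          block_sum_label_mat[OF kl, where n = n and d = d and c = c and e = e and x = x]
        by (simp add: block_estimate_def dz card_block flip: z_def w_def X_def)
      \<comment> \<open>A block is a product of a row class and a column class, so the two lower
        bounds on class sizes multiply. This unlocks \<open>blk\<close>.\<close>
      moreover have "real n * real d * \<eta>\<^sup>2 \<le> real (card (block n d c e k l))"
        using mult_mono[OF cardz[OF kl(1)] cardw[OF kl(2)]] \<eta>(2)
        by (simp add: card_block power2_eq_square algebra_simps)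
      ultimately show ?thesis using blk[OF kl] by simp
    qed
    let ?V = "(\<lambda>k. \<bar>row_prop ?E $ k - row_prop \<theta> $ k\<bar>) ` {..<g} \<union>
         (\<lambda>l. \<bar>col_prop ?E $ l - col_prop \<theta> $ l\<bar>) ` {..<m} \<union>
         (\<lambda>kl. \<bar>conn ?E $$ kl - conn \<theta> $$ kl\<bar>) ` ({..<g} \<times> {..<m})"
    have "Max ?V \<le> t"
    proof (rule Max.boundedI)
      show "finite ?V" by simp
      show "?V \<noteq> {}" using pos by auto
    qed (use r cl k in auto)
    then show ?thesis by (simp add: dinf_def dims)
  qed
  ultimately show "dinf (permute_param (switching_perm (z_hat Sg X) z) (switching_perm (w_hat Sm X) w)
      (theta_hat Sg Sm X)) \<theta> \<le> ereal t" by simp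
qed

section \<open>The error probability\<close>

definition lg_error :: "lbm_param \<Rightarrow> nat \<Rightarrow> nat \<Rightarrow> real \<Rightarrow> real \<Rightarrow> real \<Rightarrow> (real mat \<times> real mat \<times> real mat) set" where
  "lg_error \<theta> g m Sg Sm t = {(z, w, X).
     let zh = z_hat Sg X; wh = w_hat Sm X in
     g_hat Sg X \<noteq> g \<or> m_hat Sm X \<noteq> m \<or> \<not> part_equiv zh z \<or> \<not> part_equiv wh w \<or>
     dinf (permute_param (switching_perm zh z) (switching_perm wh w) (theta_hat Sg Sm X)) \<theta> > ereal t}"

lemma prob_UN_le:
  assumes "finite I" "\<And>i. i \<in> I \<Longrightarrow> measure_pmf.prob M (A i) \<le> b"
  shows "measure_pmf.prob M (\<Union>i\<in>I. A i) \<le> real (card I) * b"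
proof -
  have "measure_pmf.prob M (\<Union>i\<in>I. A i) \<le> (\<Sum>i\<in>I. measure_pmf.prob M (A i))"
    using assms(1) by (intro measure_pmf.finite_measure_subadditive_finite) auto
  also have "\<dots> \<le> real (card I) * b" using assms(2) by (rule sum_bounded_above)
  finally show ?thesis .
qed

lemma prob_Un_le:
  assumes "measure_pmf.prob M A \<le> a" "measure_pmf.prob M B \<le> b"
  shows "measure_pmf.prob M (A \<union> B) \<le> a + b"
  using measure_Un_le[of A "measure_pmf M" B] assms by simp

text \<open>Union bound over five families of bad events: row means, column means, row proportions,
  column proportions and block means. Outside all of them \<open>largest_gaps_good_event\<close>
  rules out an error.\<close>

lemma lg_error_prob_le:
  assumes par: "lbm_parameter g m \<theta>" and pos: "0 < g" "0 < m" "0 < n" "0 < d" "0 < Sg" "0 < Sm" "0 < t"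
    and \<eta>: "\<eta> \<le> t" "0 < \<eta>" "\<And>k. k < g \<Longrightarrow> 2 * \<eta> \<le> row_prop \<theta> $ k" "\<And>l. l < m \<Longrightarrow> 2 * \<eta> \<le> col_prop \<theta> $ l"
    and sepg: "\<And>k k'. k < g \<Longrightarrow> k' < g \<Longrightarrow> k \<noteq> k' \<Longrightarrow> 2 * Sg < \<bar>tau \<theta> k - tau \<theta> k'\<bar>"
    and sepm: "\<And>l l'. l < m \<Longrightarrow> l' < m \<Longrightarrow> l \<noteq> l' \<Longrightarrow> 2 * Sm < \<bar>xi \<theta> l - xi \<theta> l'\<bar>"
  shows "measure_pmf.prob (lbm_pmf \<theta> n d) (lg_error \<theta> g m Sg Sm t) \<le>
      real n * (2 * exp (- 2 * real d * (Sg / 2)\<^sup>2)) + real d * (2 * exp (- 2 * real n * (Sm / 2)\<^sup>2)) +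
      real g * (2 * exp (- 2 * real n * \<eta>\<^sup>2)) + real m * (2 * exp (- 2 * real d * \<eta>\<^sup>2)) +
      real (g * m) * (2 * exp (- 2 * (real n * real d * \<eta>\<^sup>2) * t\<^sup>2))"
proof -
  let ?N0 = "real n * real d * \<eta>\<^sup>2"
  let ?F = "\<lambda>(c, e, x). (label_mat n g c, label_mat d m e, bool_mat n d x)"
  let ?P = "label_pmf \<theta> n d"
  define R where "R i = {(c, e :: nat \<Rightarrow> nat, x). Sg / 2 < \<bar>real (card {j\<in>{..<d}. x (i, j)}) / real d - tau \<theta> (c i)\<bar>}" for i :: nat
  define C where "C j = {(c :: nat \<Rightarrow> nat, e, x). Sm / 2 < \<bar>real (card {i\<in>{..<n}. x (i, j)}) / real n - xi \<theta> (e j)\<bar>}" for j :: nat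
  define U where "U k = {(c, e :: nat \<Rightarrow> nat, x :: nat \<times> nat \<Rightarrow> bool). \<eta> < \<bar>real (card {i\<in>{..<n}. c i = k}) / real n - row_prop \<theta> $ k\<bar>}" for k :: nat
  define V where "V l = {(c :: nat \<Rightarrow> nat, e, x :: nat \<times> nat \<Rightarrow> bool). \<eta> < \<bar>real (card {j\<in>{..<d}. e j = l}) / real d - col_prop \<theta> $ l\<bar>}" for l :: nat
  define W where "W = (\<lambda>(k, l). {(c, e, x). ?N0 \<le> real (card (block n d c e k l)) \<and>
         t < \<bar>real (card {b\<in>block n d c e k l. x b}) / real (card (block n d c e k l)) - conn \<theta> $$ (k, l)\<bar>})"
  let ?E = "(\<Union>i\<in>{..<n}. R i) \<union> (\<Union>j\<in>{..<d}. C j) \<union> (\<Union>k\<in>{..<g}. U k) \<union> (\<Union>l\<in>{..<m}. V l) \<union>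
     (\<Union>kl\<in>{..<g} \<times> {..<m}. W kl)"
  have "measure_pmf.prob (lbm_pmf \<theta> n d) (lg_error \<theta> g m Sg Sm t)
      = measure_pmf.prob ?P (?F -` lg_error \<theta> g m Sg Sm t)"
    by (simp add: lbm_pmf_conv_label_pmf[OF par])
  \<comment> \<open>The inclusion of events is only claimed on the support, where all labels are in
    range.\<close>
  also have "\<dots> \<le> measure_pmf.prob ?P ?E"
  proof (intro measure_pmf.finite_measure_mono_AE AE_pmfI impI)
    fix \<omega> assume \<omega>: "\<omega> \<in> set_pmf ?P" "\<omega> \<in> ?F -` lg_error \<theta> g m Sg Sm t"
    obtain c e x where [simp]: "\<omega> = (c, e, x)" by (cases \<omega>)
    have range: "\<And>i. i < n \<Longrightarrow> c i < g" "\<And>j. j < d \<Longrightarrow> e j < m"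
      using label_pmf_range[OF par] \<omega>(1) by auto
    show "\<omega> \<in> ?E"
    proof (rule ccontr)
      assume nE: "\<omega> \<notin> ?E"
      have row: "\<bar>real (card {j\<in>{..<d}. x (i, j)}) / real d - tau \<theta> (c i)\<bar> \<le> Sg / 2" if "i < n" for i
        using nE that by (fastforce simp: R_def not_less)
      have col: "\<bar>real (card {i\<in>{..<n}. x (i, j)}) / real n - xi \<theta> (e j)\<bar> \<le> Sm / 2" if "j < d" for j
        using nE that by (fastforce simp: C_def not_less)
      have rowc: "\<bar>real (card {i\<in>{..<n}. c i = k}) / real n - row_prop \<theta> $ k\<bar> \<le> \<eta>" if "k < g" for k
        using nE that by (fastforce simp: U_def not_less)
      have colc: "\<bar>real (card {j\<in>{..<d}. e j = l}) / real d - col_prop \<theta> $ l\<bar> \<le> \<eta>" if "l < m" for l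
        using nE that by (fastforce simp: V_def not_less)
      have blk: "\<bar>real (card {b\<in>block n d c e k l. x b}) / real (card (block n d c e k l)) - conn \<theta> $$ (k, l)\<bar> \<le> t"
        if "k < g" "l < m" "?N0 \<le> real (card (block n d c e k l))" for k l
      proof -
        have "\<omega> \<notin> W (k, l)" using nE that by blast
        then show ?thesis using that by (simp add: W_def not_less)
      qed
      show False
        using largest_gaps_good_event[where c = c and e = e and x = x,
            OF par pos range \<eta> sepg sepm row col rowc colc blk] \<omega>(2)
        by (auto simp: lg_error_def Let_def not_less)
    qed
  qed simp
  also have "\<dots> \<le> real (card {..<n}) * (2 * exp (- 2 * real d * (Sg / 2)\<^sup>2)) + real (card {..<d}) * (2 * exp (- 2 * real n * (Sm / 2)\<^sup>2)) +
      real (card {..<g}) * (2 * exp (- 2 * real n * \<eta>\<^sup>2)) + real (card {..<m}) * (2 * exp (- 2 * real d * \<eta>\<^sup>2)) +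
      real (card ({..<g} \<times> {..<m})) * (2 * exp (- 2 * ?N0 * t\<^sup>2))"
  proof (intro prob_Un_le prob_UN_le)
    show "measure_pmf.prob ?P (R i) \<le> 2 * exp (- 2 * real d * (Sg / 2)\<^sup>2)" if "i \<in> {..<n}" for i
      unfolding R_def using that pos by (intro row_mean_deviation[OF par]) auto
    show "measure_pmf.prob ?P (C j) \<le> 2 * exp (- 2 * real n * (Sm / 2)\<^sup>2)" if "j \<in> {..<d}" for j
      unfolding C_def using that pos by (intro col_mean_deviation[OF par]) auto
    show "measure_pmf.prob ?P (U k) \<le> 2 * exp (- 2 * real n * \<eta>\<^sup>2)" if "k \<in> {..<g}" for k
      unfolding U_def using that pos \<eta>(2) by (intro row_class_deviation[OF par]) auto
    show "measure_pmf.prob ?P (V l) \<le> 2 * exp (- 2 * real d * \<eta>\<^sup>2)" if "l \<in> {..<m}" for l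
      unfolding V_def using that pos \<eta>(2) by (intro col_class_deviation[OF par]) auto
    show "measure_pmf.prob ?P (W kl) \<le> 2 * exp (- 2 * ?N0 * t\<^sup>2)" if mem: "kl \<in> {..<g} \<times> {..<m}" for kl
    proof -
      obtain k l where kl: "kl = (k, l)" "k < g" "l < m" using mem by auto
      show ?thesis unfolding W_def kl(1) prod.case
        using kl pos \<eta>(2) by (intro block_mean_deviation[OF par]) auto
    qed
  qed auto
  finally show ?thesis by (simp add: card_cartesian_product)
qed

section \<open>Limits of the terms of the bound\<close>

text \<open>Take \<open>a\<close> strictly between \<open>sqrt 2\<close> and the lower limit.
  Eventually \<open>a^2 * ln N\<close> is at most \<open>S^2 * D\<close>, so the term is at most
  \<open>2 * N powr (1 - a^2 / 2)\<close>, whose exponent is negative exactly because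
  \<open>a\<close> exceeds \<open>sqrt 2\<close>.\<close>

lemma threshold_term_tendsto_0:
  fixes N D :: "nat \<Rightarrow> nat" and S :: "nat \<Rightarrow> real"
  assumes N: "filterlim N at_top sequentially" and S: "\<And>r. 0 < S r"
    and lim: "liminf (\<lambda>r. ereal (S r * sqrt (real (D r) / ln (real (N r))))) > ereal (sqrt 2)"
  shows "(\<lambda>r. real (N r) * (2 * exp (- 2 * real (D r) * (S r / 2)\<^sup>2))) \<longlonglongrightarrow> 0"
proof -
  obtain a where a: "ereal (sqrt 2) < ereal a"
    "ereal a < liminf (\<lambda>r. ereal (S r * sqrt (real (D r) / ln (real (N r)))))"
    using ereal_dense2[OF lim] by auto
  then have a0: "0 < a" and a2: "sqrt 2 < a" by (auto intro: less_trans[of 0 "sqrt 2"])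
  have "(sqrt 2)\<^sup>2 < a\<^sup>2" using a2 by (intro power_strict_mono) auto
  then have asq: "1 - a\<^sup>2 / 2 < 0" by simp
  have ev1: "\<forall>\<^sub>F r in sequentially. a < S r * sqrt (real (D r) / ln (real (N r)))"
    using less_LiminfD[OF a(2)] by simp
  \<comment> \<open>Makes the logarithm positive, so that it can be cleared from the
    denominator.\<close>
  have ev2: "\<forall>\<^sub>F r in sequentially. 2 \<le> N r"
    using N by (auto simp: filterlim_at_top)
  have Nr: "filterlim (\<lambda>r. real (N r)) at_top sequentially"
    by (rule filterlim_compose[OF filterlim_real_sequentially N])
  have "((\<lambda>r. real (N r) powr (1 - a\<^sup>2 / 2)) \<longlongrightarrow> 0) sequentially"
    by (rule tendsto_neg_powr[OF asq Nr])
  then have lim0: "(\<lambda>r. 2 * real (N r) powr (1 - a\<^sup>2 / 2)) \<longlonglongrightarrow> 0"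
    using tendsto_mult_right_zero by blast
  have bound: "\<forall>\<^sub>F r in sequentially. real (N r) * (2 * exp (- 2 * real (D r) * (S r / 2)\<^sup>2))
      \<le> 2 * real (N r) powr (1 - a\<^sup>2 / 2)"
    using ev1 ev2
  proof eventually_elim
    case (elim r)
    have ln: "0 < ln (real (N r))" using elim(2) by simp
    have "a\<^sup>2 \<le> (S r * sqrt (real (D r) / ln (real (N r))))\<^sup>2"
      using elim(1) a0 by (intro power_mono) auto
    also have "\<dots> = (S r)\<^sup>2 * (real (D r) / ln (real (N r)))"
      using ln by (simp add: power_mult_distrib)
    finally have "a\<^sup>2 * ln (real (N r)) \<le> (S r)\<^sup>2 * real (D r)"
      using ln by (simp add: field_simps)
    then have "exp (- 2 * real (D r) * (S r / 2)\<^sup>2) \<le> exp (- (a\<^sup>2 / 2) * ln (real (N r)))"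
      by (simp add: power_divide field_simps)
    also have "\<dots> = real (N r) powr (- (a\<^sup>2 / 2))" using elim(2) by (simp add: powr_def)
    finally have "real (N r) * (2 * exp (- 2 * real (D r) * (S r / 2)\<^sup>2))
      \<le> real (N r) * (2 * real (N r) powr (- (a\<^sup>2 / 2)))"
      by (intro mult_left_mono) auto
    also have "\<dots> = 2 * (real (N r) powr 1 * real (N r) powr (- (a\<^sup>2 / 2)))"
      using elim(2) by simp
    also have "\<dots> = 2 * real (N r) powr (1 - a\<^sup>2 / 2)"
      by (subst powr_add[symmetric]) simp
    finally show ?case .
  qed
  show ?thesis
    by (rule tendsto_sandwich[OF _ bound tendsto_const lim0]) simp
qed

lemma exp_decay_tendsto_0:
  fixes c b :: real
  assumes "filterlim u at_top sequentially" "0 < b"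
  shows "(\<lambda>r. c * (2 * exp (- 2 * u r * b))) \<longlonglongrightarrow> 0"
proof -
  have "filterlim (\<lambda>r. (2 * b) * u r) at_top sequentially"
    using assms by (intro filterlim_tendsto_pos_mult_at_top[OF tendsto_const]) auto
  then have "filterlim (\<lambda>r. - ((2 * b) * u r)) at_bot sequentially"
    by (simp add: filterlim_uminus_at_top)
  then have "(\<lambda>r. exp (- ((2 * b) * u r))) \<longlonglongrightarrow> 0"
    by (rule filterlim_compose[OF exp_at_bot])
  then have "(\<lambda>r. (c * 2) * exp (- ((2 * b) * u r))) \<longlonglongrightarrow> 0"
    by (rule tendsto_mult_right_zero)
  then show ?thesis by (simp add: mult.assoc mult.left_commute mult.commute)
qed

section \<open>Positivity of separations and class probabilities\<close>

lemma min_separation_nonneg: "0 \<le> min_separation g f"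
  unfolding min_separation_def by (rule INF_greatest) auto

text \<open>Density of the reals in \<open>ereal\<close> supplies a finite \<open>\<delta>\<close>
  even for a single class, where the separation is infinite and the conclusion about pairs is
  vacuous.\<close>

lemma min_separation_pos:
  assumes "0 < min_separation g f"
  shows "\<exists>\<delta>>0. \<forall>k<g. \<forall>k'<g. k \<noteq> k' \<longrightarrow> \<delta> < \<bar>f k - f k'\<bar>"
proof -
  obtain \<delta> where \<delta>: "0 < ereal \<delta>" "ereal \<delta> < min_separation g f"
    using ereal_dense2[OF assms] by auto
  have "\<delta> < \<bar>f k - f k'\<bar>" if "k < g" "k' < g" "k \<noteq> k'" for k k'
  proof -
    have "min_separation g f \<le> ereal \<bar>f k - f k'\<bar>"
      unfolding min_separation_def using that by (intro INF_lower2[of "(k, k')"]) auto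
    then show ?thesis using \<delta>(2) by (metis ereal_less_eq(3) leD leI order_trans)
  qed
  then show ?thesis using \<delta>(1) by auto
qed

lemma vec_min_le: "k < dim_vec p \<Longrightarrow> vec_min p \<le> p $ k"
  unfolding vec_min_def by (intro Min_le) auto

lemma vec_min_nonneg: "prob_vec p \<Longrightarrow> 0 < dim_vec p \<Longrightarrow> 0 \<le> vec_min p"
  unfolding vec_min_def prob_vec_def by (subst Min_ge_iff) auto

theorem theorem2:
  fixes g m :: nat and \<theta> :: lbm_param
    and n d :: "nat \<Rightarrow> nat" and Sg Sm :: "nat \<Rightarrow> nat \<Rightarrow> real" and t :: real
  assumes "1 \<le> g" and "1 \<le> m" and "lbm_parameter g m \<theta>"
    and "vec_min (row_prop \<theta>) * vec_min (col_prop \<theta>) > 0"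
    and "delta_row \<theta> * delta_col \<theta> > 0"
    and "\<And>r. 1 \<le> n r" and "\<And>r. 1 \<le> d r"
    and "filterlim n at_top sequentially" and "filterlim d at_top sequentially"
    and "\<And>r. Sg (n r) (d r) > 0" and "\<And>r. Sm (n r) (d r) > 0"
    and "(\<lambda>r. Sg (n r) (d r)) \<longlonglongrightarrow> 0" and "(\<lambda>r. Sm (n r) (d r)) \<longlonglongrightarrow> 0"
    and "liminf (\<lambda>r. ereal (Sg (n r) (d r) * sqrt (real (d r) / ln (real (n r))))) > ereal (sqrt 2)"
    and "liminf (\<lambda>r. ereal (Sm (n r) (d r) * sqrt (real (n r) / ln (real (d r))))) > ereal (sqrt 2)"
    and "t > 0"
  shows "(\<lambda>r. measure_pmf.prob (lbm_pmf \<theta> (n r) (d r))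
           {(z, w, X).
              let zh = z_hat (Sg (n r) (d r)) X; wh = w_hat (Sm (n r) (d r)) X in
              g_hat (Sg (n r) (d r)) X \<noteq> g \<or> m_hat (Sm (n r) (d r)) X \<noteq> m \<or>
              \<not> part_equiv zh z \<or> \<not> part_equiv wh w \<or>
              dinf (permute_param (switching_perm zh z) (switching_perm wh w)
                      (theta_hat (Sg (n r) (d r)) (Sm (n r) (d r)) X)) \<theta> > ereal t})
         \<longlonglongrightarrow> 0"
proof -
  note par = assms(3)
  have dims: "dim_vec (row_prop \<theta>) = g" "dim_vec (col_prop \<theta>) = m" using par_dims[OF par] by auto
  \<comment> \<open>Nonnegativity of both factors excludes that the product is positive because both
    are negative.\<close>
  have "0 \<le> vec_min (row_prop \<theta>)" "0 \<le> vec_min (col_prop \<theta>)"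
    using par_dims[OF par] assms(1,2) by (auto intro!: vec_min_nonneg)
  then have vm: "0 < vec_min (row_prop \<theta>)" "0 < vec_min (col_prop \<theta>)"
    using assms(4) by (auto simp: zero_less_mult_iff)
  have "0 \<le> delta_row \<theta>" "0 \<le> delta_col \<theta>"
    by (auto simp: delta_row_def delta_col_def min_separation_nonneg)
  \<comment> \<open>In \<open>ereal\<close> zero times infinity is zero, so a positive product
    excludes a vanishing factor even if the other one is infinite.\<close>
  then have dpos: "0 < delta_row \<theta>" "0 < delta_col \<theta>"
    using assms(5) by (auto simp: order_less_le)
  obtain \<delta> where \<delta>: "0 < \<delta>" "\<And>k k'. k < g \<Longrightarrow> k' < g \<Longrightarrow> k \<noteq> k' \<Longrightarrow> \<delta> < \<bar>tau \<theta> k - tau \<theta> k'\<bar>"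
    using min_separation_pos[OF dpos(1)[unfolded delta_row_def dims]] by blast
  obtain \<delta>' where \<delta>': "0 < \<delta>'" "\<And>l l'. l < m \<Longrightarrow> l' < m \<Longrightarrow> l \<noteq> l' \<Longrightarrow> \<delta>' < \<bar>xi \<theta> l - xi \<theta> l'\<bar>"
    using min_separation_pos[OF dpos(2)[unfolded delta_col_def dims]] by blast
  \<comment> \<open>The bound by \<open>t\<close> makes the estimated proportions accurate to within
    \<open>t\<close>; the half of the smallest class probability keeps all classes nonempty with
    linear size.\<close>
  define \<eta> where "\<eta> = min t (min (vec_min (row_prop \<theta>)) (vec_min (col_prop \<theta>)) / 2)"
  have \<eta>: "\<eta> \<le> t" "0 < \<eta>" "2 * \<eta> \<le> vec_min (row_prop \<theta>)" "2 * \<eta> \<le> vec_min (col_prop \<theta>)"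
    using vm assms(16) by (auto simp: \<eta>_def min_def)
  have \<eta>k: "2 * \<eta> \<le> row_prop \<theta> $ k" if "k < g" for k
    using vec_min_le[of k "row_prop \<theta>"] \<eta>(3) that dims by simp
  have \<eta>l: "2 * \<eta> \<le> col_prop \<theta> $ l" if "l < m" for l
    using vec_min_le[of l "col_prop \<theta>"] \<eta>(4) that dims by simp
  let ?B = "\<lambda>r. real (n r) * (2 * exp (- 2 * real (d r) * (Sg (n r) (d r) / 2)\<^sup>2)) +
      real (d r) * (2 * exp (- 2 * real (n r) * (Sm (n r) (d r) / 2)\<^sup>2)) +
      real g * (2 * exp (- 2 * real (n r) * \<eta>\<^sup>2)) + real m * (2 * exp (- 2 * real (d r) * \<eta>\<^sup>2)) +
      real (g * m) * (2 * exp (- 2 * (real (n r) * real (d r) * \<eta>\<^sup>2) * t\<^sup>2))"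
  have "\<forall>\<^sub>F r in sequentially. Sg (n r) (d r) < \<delta> / 2" "\<forall>\<^sub>F r in sequentially. Sm (n r) (d r) < \<delta>' / 2"
    using order_tendstoD(2)[OF assms(12), of "\<delta> / 2"] order_tendstoD(2)[OF assms(13), of "\<delta>' / 2"] \<delta>(1) \<delta>'(1)
    by auto
  then have bound: "\<forall>\<^sub>F r in sequentially.
      measure_pmf.prob (lbm_pmf \<theta> (n r) (d r)) (lg_error \<theta> g m (Sg (n r) (d r)) (Sm (n r) (d r)) t) \<le> ?B r"
  proof eventually_elim
    case (elim r)
    show ?case
    proof (rule lg_error_prob_le[OF par])
      show "2 * Sg (n r) (d r) < \<bar>tau \<theta> k - tau \<theta> k'\<bar>" if "k < g" "k' < g" "k \<noteq> k'" for k k'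
        using \<delta>(2)[OF that] elim(1) by simp
      show "2 * Sm (n r) (d r) < \<bar>xi \<theta> l - xi \<theta> l'\<bar>" if "l < m" "l' < m" "l \<noteq> l'" for l l'
        using \<delta>'(2)[OF that] elim(2) by simp
    qed (use assms(1,2,6,7,10,11,16) \<eta> \<eta>k \<eta>l in \<open>auto simp: Suc_le_eq\<close>)
  qed
  have nr: "filterlim (\<lambda>r. real (n r)) at_top sequentially" "filterlim (\<lambda>r. real (d r)) at_top sequentially"
    by (rule filterlim_compose[OF filterlim_real_sequentially], fact)+
  have ndr: "filterlim (\<lambda>r. real (n r) * real (d r) * \<eta>\<^sup>2) at_top sequentially"
    using \<eta>(2) by (intro filterlim_at_top_mult_tendsto_pos[OF tendsto_const] filterlim_at_top_mult_at_top nr) auto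
  \<comment> \<open>The first two summands vanish by the conditions on the thresholds; in the other
    three the factor in front is constant and the exponent diverges.\<close>
  have "?B \<longlonglongrightarrow> 0 + 0 + 0 + 0 + 0"
    using \<eta>(2) assms(16)
    by (intro tendsto_add threshold_term_tendsto_0 exp_decay_tendsto_0 assms nr ndr) auto
  then have "?B \<longlonglongrightarrow> 0" by simp
  with bound have "(\<lambda>r. measure_pmf.prob (lbm_pmf \<theta> (n r) (d r))
      (lg_error \<theta> g m (Sg (n r) (d r)) (Sm (n r) (d r)) t)) \<longlonglongrightarrow> 0"
    by (intro tendsto_sandwich[OF _ bound tendsto_const]) auto
  then show ?thesis unfolding lg_error_def .
qed

end
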